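(* Let $\Omega\subset\mathbb{R}^n$ be a $C^1$ domain, and $u\in C(\mathbb{R}^n)$. Then, for all $s\in(0,1)$, $$\lim_{\substack{x\to\partial\Omega\\ x\in\mathbb{R}^n\setminus\overline{\Omega}}}\tilde{\mathcal{N}}_su(x)=0.$$ Also, if $s>\frac12$ and $u\in C^{1,\alpha}(\mathbb{R}^n)$ for some $\alpha\in(0,2s-1)$, then $$\partial_\nu\tilde{\mathcal{N}}_su(x):=\lim_{\epsilon\to0^+}\frac{\tilde{\mathcal{N}}_su(x+\epsilon\nu)}{\epsilon}=\kappa\,\partial_\nu u\qquad\text{for any }x\in\partial\Omega,$$ for some constant $\kappa>0$.
   Context: The renormalized nonlocal normal derivative is $$\tilde{\mathcal{N}}_su(x)=\frac{\int_\Omega\frac{u(x)-u(y)}{|x-y|^{n+2s}}\,dy}{\int_\Omega\frac{dy}{|x-y|^{n+2s}}},\qquad x\in\mathbb{R}^n\setminus\overline{\Omega}.$$ Here $\nu$ is the exterior unit normal to $\partial\Omega$ at $x$, and $\partial_\nu u$ is the derivative of $u$ in direction $\nu$ at $x$. *)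

theory Defs
  imports "HOL-Analysis.Analysis"
begin

text \<open>
  \<open>local_C1_graph \<Omega> x e \<gamma> g r\<close>: in the ball of radius \<open>r\<close> around \<open>x\<close>, the set \<open>\<Omega>\<close> is the
  region above the graph of a \<open>C\<^sup>1\<close> function over the hyperplane orthogonal to the unit
  vector \<open>e\<close>.  The coordinate of \<open>y\<close> along \<open>e\<close> is \<open>y \<bullet> e\<close> and its projection to the
  hyperplane is \<open>y - (y \<bullet> e) *\<^sub>R e\<close>.  The function \<open>\<gamma>\<close>, with gradient \<open>g\<close>, is given on the
  whole space only for convenience: a \<open>C\<^sup>1\<close> function on the hyperplane extends by composing it
  with the projection, and only values on the hyperplane are used.
\<close>

definition local_C1_graph ::
  "'a::euclidean_space set \<Rightarrow> 'a \<Rightarrow> 'a \<Rightarrow> ('a \<Rightarrow> real) \<Rightarrow> ('a \<Rightarrow> 'a) \<Rightarrow> real \<Rightarrow> bool" where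
  "local_C1_graph \<Omega> x e \<gamma> g r \<longleftrightarrow>
     norm e = 1 \<and> 0 < r \<and>
     (\<forall>z. GDERIV \<gamma> z :> g z) \<and> continuous_on UNIV g \<and>
     \<Omega> \<inter> ball x r = {y \<in> ball x r. \<gamma> (y - (y \<bullet> e) *\<^sub>R e) < y \<bullet> e}"

definition C1_domain :: "'a::euclidean_space set \<Rightarrow> bool" where
  "C1_domain \<Omega> \<longleftrightarrow>
     open \<Omega> \<and> connected \<Omega> \<and> \<Omega> \<noteq> {} \<and>
     (\<forall>x\<in>frontier \<Omega>. \<exists>e \<gamma> g r. local_C1_graph \<Omega> x e \<gamma> g r)"

text \<open>
  Locally \<open>\<Omega>\<close> is the sublevel set \<open>\<phi> < 0\<close> of \<open>\<phi> y = \<gamma> (y - (y \<bullet> e) *\<^sub>R e) - y \<bullet> e\<close>, so the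
  exterior unit normal is the normalized gradient of \<open>\<phi>\<close>; here \<open>p\<close> is the gradient of \<open>\<gamma>\<close>
  at the projection of \<open>x\<close>, and \<open>p - (p \<bullet> e) *\<^sub>R e\<close> its part tangential to the hyperplane.
\<close>

definition exterior_unit_normal :: "'a::euclidean_space set \<Rightarrow> 'a \<Rightarrow> 'a \<Rightarrow> bool" where
  "exterior_unit_normal \<Omega> x \<nu> \<longleftrightarrow>
     (\<exists>e \<gamma> g r. local_C1_graph \<Omega> x e \<gamma> g r \<and>
        (let p = g (x - (x \<bullet> e) *\<^sub>R e) in \<nu> = sgn (p - (p \<bullet> e) *\<^sub>R e - e)))"

text \<open>
  The class \<open>C\<^sup>1\<^sup>,\<^sup>\<alpha>\<close> on the whole space: the gradient is globally \<open>\<alpha>\<close>-Hoelder continuous.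
  Boundedness of the function and of its gradient is not required.
\<close>

definition C1_Holder :: "real \<Rightarrow> ('a::euclidean_space \<Rightarrow> real) \<Rightarrow> bool" where
  "C1_Holder \<alpha> u \<longleftrightarrow>
     (\<exists>g C. (\<forall>x. GDERIV u x :> g x) \<and> (\<forall>x y. norm (g x - g y) \<le> C * dist x y powr \<alpha>))"

definition dir_deriv :: "('a::euclidean_space \<Rightarrow> real) \<Rightarrow> 'a \<Rightarrow> 'a \<Rightarrow> real" where
  "dir_deriv u x v = deriv (\<lambda>t. u (x + t *\<^sub>R v)) 0"

definition renorm_nonlocal_normal_deriv ::
  "real \<Rightarrow> 'a::euclidean_space set \<Rightarrow> ('a \<Rightarrow> real) \<Rightarrow> 'a \<Rightarrow> real" where
  "renorm_nonlocal_normal_deriv s \<Omega> u x =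
     (LINT y:\<Omega>|lborel. (u x - u y) / norm (x - y) powr (real DIM('a) + 2 * s)) /
     (LINT y:\<Omega>|lborel. 1 / norm (x - y) powr (real DIM('a) + 2 * s))"

text \<open>
  The filter of points of \<open>S\<close> tending to the set \<open>A\<close>, generated by the open neighbourhoods
  of \<open>A\<close>.  Convergence along it is convergence at every point of \<open>A\<close>; for compact \<open>A\<close> it
  is uniform convergence as the distance to \<open>A\<close> tends to 0.
\<close>

definition at_set_within :: "'a::topological_space set \<Rightarrow> 'a set \<Rightarrow> 'a filter" where
  "at_set_within A S = (INF U\<in>{U. open U \<and> A \<subseteq> U}. principal (U \<inter> S))"

lemma eventually_at_set_within:
  "eventually P (at_set_within A S) \<longleftrightarrow> (\<exists>U. open U \<and> A \<subseteq> U \<and> (\<forall>x\<in>U \<inter> S. P x))"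
  unfolding at_set_within_def
proof (subst eventually_INF_base)
  show "{U. open U \<and> A \<subseteq> U} \<noteq> {}"
    using open_UNIV by blast
next
  fix U V assume "U \<in> {U. open U \<and> A \<subseteq> U}" "V \<in> {U. open U \<and> A \<subseteq> U}"
  then show "\<exists>W\<in>{U. open U \<and> A \<subseteq> U}.
      principal (W \<inter> S) \<le> inf (principal (U \<inter> S)) (principal (V \<inter> S))"
    by (intro bexI[of _ "U \<inter> V"]) auto
qed (auto simp: eventually_principal)

lemma filterlim_at_set_within_iff:
  assumes "A \<inter> S = {}"
  shows "filterlim f F (at_set_within A S) \<longleftrightarrow> (\<forall>x\<in>A. filterlim f F (at x within S))"
proof -
  have *: "eventually P (at_set_within A S) \<longleftrightarrow> (\<forall>x\<in>A. eventually P (at x within S))" for P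
  proof
    assume "eventually P (at_set_within A S)"
    then show "\<forall>x\<in>A. eventually P (at x within S)"
      unfolding eventually_at_set_within eventually_at_topological by blast
  next
    assume "\<forall>x\<in>A. eventually P (at x within S)"
    then obtain V where V: "\<And>x. x \<in> A \<Longrightarrow>
        open (V x) \<and> x \<in> V x \<and> (\<forall>y\<in>V x. y \<noteq> x \<longrightarrow> y \<in> S \<longrightarrow> P y)"
      unfolding eventually_at_topological by metis
    have "open (\<Union>x\<in>A. V x)" "A \<subseteq> (\<Union>x\<in>A. V x)"
      using V by auto
    moreover have "P y" if yV: "y \<in> (\<Union>x\<in>A. V x) \<inter> S" for y
    proof -
      obtain x where x: "x \<in> A" "y \<in> V x" and y: "y \<in> S"
        using yV by blast
      have "y \<noteq> x"
        using x(1) y assms by blast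
      then show "P y"
        using V[OF x(1)] x(2) y by simp
    qed
    ultimately show "eventually P (at_set_within A S)"
      unfolding eventually_at_set_within by blast
  qed
  show ?thesis
    by (simp add: filterlim_iff *) blast
qed

lemma exterior_unit_normal_exists:
  assumes "C1_domain \<Omega>" "x \<in> frontier \<Omega>"
  shows "\<exists>\<nu>. exterior_unit_normal \<Omega> x \<nu>"
  using assms unfolding C1_domain_def exterior_unit_normal_def Let_def by blast

lemma exterior_unit_normal_norm:
  assumes "exterior_unit_normal \<Omega> x \<nu>"
  shows "norm \<nu> = 1"
proof -
  obtain e p where e: "norm e = 1" and \<nu>: "\<nu> = sgn (p - (p \<bullet> e) *\<^sub>R e - e)"
    using assms unfolding exterior_unit_normal_def local_C1_graph_def Let_def by blast
  have "(p - (p \<bullet> e) *\<^sub>R e - e) \<bullet> e = - 1"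
    using e by (simp add: inner_diff_left dot_square_norm)
  then have "p - (p \<bullet> e) *\<^sub>R e - e \<noteq> 0"
    by force
  then show ?thesis
    unfolding \<nu> norm_sgn by simp
qed

end

theory Submission
  imports Defs
begin

text \<open>
  Near a boundary point \<open>x\<close> with exterior unit normal \<open>\<nu>\<close>, differentiability of the local graph
  says that \<open>\<Omega>\<close> contains, and its complement contains, cones around \<open>- \<nu>\<close> and \<open>\<nu>\<close> of any
  opening less than a half-space; nothing more about the boundary is needed.  An interior ball
  of radius comparable to \<open>norm (x' - x)\<close> makes the denominator at \<open>x'\<close> at least
  \<open>K * norm (x' - x) powr (- 2 * s)\<close>, while the numerator is at most a small multiple of the
  denominator, by continuity of \<open>u\<close>, plus a bounded far part; this gives the limit 0.

  For the normal derivative, put \<open>x' = x + \<epsilon> *\<^sub>R \<nu>\<close> and \<open>y = x' - \<epsilon> *\<^sub>R z\<close>.  The blown-up domains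
  converge to the half-space \<open>1 < z \<bullet> \<nu>\<close> and stay away from \<open>z = 0\<close>, the difference quotients of
  \<open>u\<close> converge to \<open>z \<bullet> g x\<close> and are bounded by a multiple of \<open>norm z powr (1 + \<alpha>)\<close>.  Since
  \<open>1 + \<alpha> < 2 * s\<close>, dominated convergence applies.  By rotation invariance of Lebesgue measure only
  the \<open>\<nu>\<close>-component of the gradient contributes, and \<open>\<kappa>\<close> is the quotient of the integrals of
  \<open>(z \<bullet> \<nu>) / norm z powr p\<close> and \<open>1 / norm z powr p\<close> over the half-space, where
  \<open>p = DIM('a) + 2 * s\<close>.
\<close>

subsection \<open>Lebesgue measure and orthogonal maps\<close>

lemma nn_integral_lborel_translate:
  fixes f :: "'a::euclidean_space \<Rightarrow> ennreal"
  assumes "f \<in> borel_measurable borel"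
  shows "(\<integral>\<^sup>+x. f (x + c) \<partial>lborel) = (\<integral>\<^sup>+x. f x \<partial>lborel)"
proof -
  have "(\<integral>\<^sup>+x. f x \<partial>lborel) = (\<integral>\<^sup>+x. f x \<partial>distr lborel borel ((+) c))"
    by (simp add: lborel_distr_plus)
  also have "\<dots> = (\<integral>\<^sup>+x. f (x + c) \<partial>lborel)"
    using assms by (subst nn_integral_distr) (auto simp: add.commute)
  finally show ?thesis ..
qed

text \<open>
  Uniqueness of Haar measure: the double integral of
  \<open>indicator A (f x) * indicator (ball 0 1) (y - f x)\<close>, evaluated in both orders, gives
  \<open>emeasure lborel (f -` A) * V = V * emeasure lborel A\<close> with \<open>V\<close> the volume of the unit ball.
\<close>

lemma lborel_distr_orthogonal_transformation:
  fixes f :: "'a::euclidean_space \<Rightarrow> 'a"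
  assumes f: "orthogonal_transformation f"
  shows "distr lborel borel f = lborel"
proof (rule measure_eqI)
  show "sets (distr lborel borel f) = sets lborel" by simp
next
  have lin: "linear f"
    using f by (rule orthogonal_transformation_linear)
  have [measurable]: "f \<in> borel_measurable borel"
    using lin by (intro borel_measurable_continuous_onI linear_continuous_on)
      (simp add: linear_linear)
  fix A assume "A \<in> sets (distr lborel borel f)"
  then have A[measurable]: "A \<in> sets borel" by simp
  define B where "B = ball (0::'a) 1"
  have [measurable]: "B \<in> sets borel" by (simp add: B_def)
  let ?I = "\<lambda>S x. indicator S x :: ennreal"
  let ?V = "emeasure lborel B"
  have surj: "f (inv f y) = y" for y
    using f by (simp add: orthogonal_transformation_surj surj_f_inv_f)
  have "(\<integral>\<^sup>+x. ?I A (f x) \<partial>lborel) * ?V = (\<integral>\<^sup>+x. ?I A (f x) * ?V \<partial>lborel)"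
    by (simp add: nn_integral_multc)
  also have "\<dots> = (\<integral>\<^sup>+x. (\<integral>\<^sup>+y. ?I A (f x) * ?I B (y - f x) \<partial>lborel) \<partial>lborel)"
  proof (rule nn_integral_cong)
    fix x
    have "?V = (\<integral>\<^sup>+y. ?I B (y - f x) \<partial>lborel)"
      using nn_integral_lborel_translate[of "?I B" "- f x"] by simp
    then show "?I A (f x) * ?V = (\<integral>\<^sup>+y. ?I A (f x) * ?I B (y - f x) \<partial>lborel)"
      by (simp add: nn_integral_cmult)
  qed
  also have "\<dots> = (\<integral>\<^sup>+y. (\<integral>\<^sup>+x. ?I A (f x) * ?I B (y - f x) \<partial>lborel) \<partial>lborel)"
    by (rule lborel_pair.Fubini') measurable
  \<comment> \<open>The substitution \<open>x + inv f y\<close> for \<open>x\<close> moves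
    \<open>y\<close> out of the ball factor and into the argument of \<open>A\<close>.\<close>
  also have "\<dots> = (\<integral>\<^sup>+y. (\<integral>\<^sup>+x. ?I A (f x + y) * ?I B (- f x) \<partial>lborel) \<partial>lborel)"
  proof (rule nn_integral_cong)
    fix y
    show "(\<integral>\<^sup>+x. ?I A (f x) * ?I B (y - f x) \<partial>lborel) =
        (\<integral>\<^sup>+x. ?I A (f x + y) * ?I B (- f x) \<partial>lborel)"
      using nn_integral_lborel_translate[of "\<lambda>x. ?I A (f x) * ?I B (y - f x)" "inv f y"]
      by (simp add: linear_add[OF lin] surj)
  qed
  also have "\<dots> = (\<integral>\<^sup>+x. (\<integral>\<^sup>+y. ?I A (f x + y) * ?I B (- f x) \<partial>lborel) \<partial>lborel)"
    by (rule lborel_pair.Fubini'[symmetric]) measurable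
  also have "\<dots> = (\<integral>\<^sup>+x. emeasure lborel A * ?I B x \<partial>lborel)"
  proof (rule nn_integral_cong)
    fix x
    have "?I B (- f x) = ?I B x"
      by (simp add: B_def indicator_def orthogonal_transformation_norm[OF f])
    moreover have "(\<integral>\<^sup>+y. ?I A (f x + y) \<partial>lborel) = emeasure lborel A"
      using nn_integral_lborel_translate[of "?I A" "f x"] by (simp add: add.commute)
    ultimately show "(\<integral>\<^sup>+y. ?I A (f x + y) * ?I B (- f x) \<partial>lborel) = emeasure lborel A * ?I B x"
      by (simp add: nn_integral_multc)
  qed
  also have "\<dots> = emeasure lborel A * ?V"
    by (simp add: nn_integral_cmult)
  finally have "(\<integral>\<^sup>+x. ?I A (f x) \<partial>lborel) * ?V = emeasure lborel A * ?V" .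
  \<comment> \<open>Cancelling the volume in \<open>ennreal\<close> requires it to be neither 0 nor
    infinite.\<close>
  moreover have V: "?V \<noteq> 0" "?V \<noteq> top"
    using content_ball_pos[of 1 "0::'a"] emeasure_lborel_ball_finite[of "0::'a" 1]
    by (auto simp: B_def measure_def)
  ultimately have "(\<integral>\<^sup>+x. ?I A (f x) \<partial>lborel) = emeasure lborel A"
    using ennreal_mult_divide_eq[OF V] by metis
  moreover have "emeasure (distr lborel borel f) A = (\<integral>\<^sup>+x. ?I A (f x) \<partial>lborel)"
    by (simp add: nn_integral_distr flip: nn_integral_indicator)
  ultimately show "emeasure (distr lborel borel f) A = emeasure lborel A" by simp
qed

text \<open>This is the reflection in the hyperplane orthogonal to \<open>c\<close>. For
  \<open>c = 0\<close>, division by zero makes it the identity, so it can be applied to a difference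
  of two vectors that may coincide.\<close>

lemma orthogonal_transformation_reflection:
  fixes c :: "'a::euclidean_space"
  shows "orthogonal_transformation (\<lambda>z. z - (2 * (z \<bullet> c) / (c \<bullet> c)) *\<^sub>R c)"
proof (cases "c = 0")
  case False
  then have "c \<bullet> c \<noteq> 0" by simp
  then show ?thesis
    unfolding orthogonal_transformation_def
    by (auto intro!: linearI simp: algebra_simps inner_simps add_divide_distrib inner_commute)
qed simp

lemma integral_lborel_orthogonal_transformation:
  fixes f :: "'a::euclidean_space \<Rightarrow> 'a" and h :: "'a \<Rightarrow> real"
  assumes f: "orthogonal_transformation f" and h: "h \<in> borel_measurable borel"
  shows "(\<integral>x. h (f x) \<partial>lborel) = (\<integral>x. h x \<partial>lborel)"
proof -
  have "f \<in> borel_measurable borel"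
    using orthogonal_transformation_linear[OF f]
    by (intro borel_measurable_continuous_onI linear_continuous_on) (simp add: linear_linear)
  then have "(\<integral>x. h x \<partial>distr lborel borel f) = (\<integral>x. h (f x) \<partial>lborel)"
    using h by (simp add: integral_distr)
  then show ?thesis
    by (simp add: lborel_distr_orthogonal_transformation[OF f])
qed

section \<open>Affine substitution, and integrability of powers of the norm at infinity\<close>

lemma integral_lborel_affine:
  fixes f :: "'a::euclidean_space \<Rightarrow> real"
  assumes "f \<in> borel_measurable borel" "c \<noteq> 0"
  shows "(\<integral>x. f x \<partial>lborel) = \<bar>c\<bar> ^ DIM('a) * (\<integral>x. f (t + c *\<^sub>R x) \<partial>lborel)"
proof -
  have "(\<integral>x. f x \<partial>lborel) =
      (\<integral>x. f x \<partial>density (distr lborel borel (\<lambda>x. t + c *\<^sub>R x)) (\<lambda>_. ennreal (\<bar>c\<bar> ^ DIM('a))))"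
    using lborel_affine[OF assms(2), of t] by (simp add: ennreal_power)
  also have "\<dots> = \<bar>c\<bar> ^ DIM('a) * (\<integral>x. f (t + c *\<^sub>R x) \<partial>lborel)"
    using assms(1) by (subst integral_density) (auto simp: integral_distr)
  finally show ?thesis .
qed

lemma integrable_lborel_affine:
  fixes f :: "'a::euclidean_space \<Rightarrow> real"
  assumes f: "integrable lborel f" and c: "c \<noteq> 0"
  shows "integrable lborel (\<lambda>x. f (t + c *\<^sub>R x))"
proof -
  have [measurable]: "f \<in> borel_measurable borel"
    using f by auto
  have "integrable (density (distr lborel borel (\<lambda>x. t + c *\<^sub>R x)) (\<lambda>_. ennreal (\<bar>c\<bar> ^ DIM('a)))) f"
    using lborel_affine[OF c, of t] f by (simp add: ennreal_power)
  then show ?thesis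
    using c by (subst (asm) integrable_density) (auto simp: integrable_distr_eq)
qed

text \<open>Dyadic decomposition: where \<open>norm z\<close> lies between \<open>r * 2 ^ k\<close>
  and \<open>2 * r * 2 ^ k\<close>, the integrand is at most \<open>(r * 2 ^ k) powr (- a)\<close>.
  Enlarging each shell to the full ball gives the majorants \<open>g k\<close>, whose integrals form
  a geometric series with ratio \<open>q = 2 powr (n - a) < 1\<close>.\<close>

lemma set_integrable_norm_powr:
  fixes r a :: real
  assumes r: "0 < r" and a: "real DIM('a) < a"
  shows "set_integrable lborel {z::'a::euclidean_space. r \<le> norm z} (\<lambda>z. norm z powr (- a))"
proof -
  define n where "n = DIM('a)"
  define V where "V = measure lborel (ball (0::'a) 1)"
  define q where "q = 2 powr (real n - a)"
  define C where "C = r powr (- a) * (2 * r) ^ n * V"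
  have q: "0 < q" "q < 1"
    using a by (auto simp: q_def n_def powr_less_one)
  have V: "0 < V"
    unfolding V_def by (intro content_ball_pos) simp
  have C: "0 < C"
    using r V by (simp add: C_def)
  let ?f = "\<lambda>z::'a. indicator {z. r \<le> norm z} z *\<^sub>R norm z powr (- a)"
  define g :: "nat \<Rightarrow> 'a \<Rightarrow> ennreal" where
    "g k z = ennreal ((r * 2 ^ k) powr (- a)) * indicator (ball 0 (2 * r * 2 ^ k)) z" for k z
  have g_meas: "g k \<in> borel_measurable lborel" for k
  proof -
    have b: "ball (0::'a) (2 * r * 2 ^ k) \<in> sets lborel"
      unfolding sets_lborel by (intro borel_open open_ball)
    show ?thesis
      unfolding g_def[abs_def]
      by (rule borel_measurable_times_ennreal[OF borel_measurable_const borel_measurable_indicator[OF b]])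
  qed
  have g_int: "(\<integral>\<^sup>+z. g k z \<partial>lborel) = ennreal (C * q ^ k)" for k
  proof -
    have "emeasure lborel (ball (0::'a) (2 * r * 2 ^ k)) = ennreal (measure lborel (ball (0::'a) (2 * r * 2 ^ k)))"
      using emeasure_lborel_ball_finite[of "0::'a" "2 * r * 2 ^ k"]
      by (simp add: emeasure_eq_ennreal_measure)
    also have "measure lborel (ball (0::'a) (2 * r * 2 ^ k)) = (2 * r * 2 ^ k) ^ n * V"
      unfolding n_def V_def using r by (intro content_ball_conv_unit_ball) auto
    finally have "(\<integral>\<^sup>+z. g k z \<partial>lborel) = ennreal ((r * 2 ^ k) powr (- a) * ((2 * r * 2 ^ k) ^ n * V))"
      using V r by (simp add: g_def nn_integral_cmult_indicator ennreal_mult)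
    also have "(r * 2 ^ k) powr (- a) * ((2 * r * 2 ^ k) ^ n * V) = C * ((2 ^ k) powr (- a) * (2 ^ k) ^ n)"
      using r by (simp add: C_def powr_mult power_mult_distrib)
    also have "(2 ^ k) powr (- a) * (2 ^ k) ^ n = q ^ k"
      by (simp add: q_def powr_powr powr_add[symmetric] flip: powr_realpow) (simp add: algebra_simps)
    finally show ?thesis .
  qed
  have le_suminf: "f j \<le> (\<Sum>k. f k)" for f :: "nat \<Rightarrow> ennreal" and j
    using sum_le_suminf[of f "{j}"] by (simp add: summableI)
  have pt: "ennreal (?f z) \<le> (\<Sum>k. g k z)" for z
  proof (cases "r \<le> norm z")
    case True
    obtain m where "norm z / r < 2 ^ m"
      using real_arch_pow[of 2 "norm z / r"] by auto
    then have m: "norm z < r * 2 ^ m"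
      using r by (simp add: field_simps)
    \<comment> \<open>The shell containing \<open>z\<close> has index \<open>j = k - 1\<close>:
      minimality of \<open>k\<close> gives its lower bound, and \<open>r \<le> norm z\<close>
      excludes \<open>k = 0\<close>.\<close>
    define k where "k = (LEAST m. norm z < r * 2 ^ m)"
    have k: "norm z < r * 2 ^ k"
      unfolding k_def by (rule LeastI[of _ m]) (rule m)
    then obtain j where j: "k = Suc j"
      using True by (cases k) auto
    have jl: "r * 2 ^ j \<le> norm z"
      using not_less_Least[of j "\<lambda>m. norm z < r * 2 ^ m"] j unfolding k_def by auto
    have "ennreal (?f z) \<le> g j z"
      using True k j r jl a by (auto intro!: ennreal_leI powr_mono2' simp: indicator_def g_def)
    also have "\<dots> \<le> (\<Sum>k. g k z)"
      by (rule le_suminf)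
    finally show ?thesis .
  qed simp
  have "(\<integral>\<^sup>+z. ennreal (?f z) \<partial>lborel) \<le> (\<integral>\<^sup>+z. (\<Sum>k. g k z) \<partial>lborel)"
    by (intro nn_integral_mono pt)
  also have "\<dots> = (\<Sum>k. \<integral>\<^sup>+z. g k z \<partial>lborel)"
    by (rule nn_integral_suminf) (rule g_meas)
  also have "\<dots> = (\<Sum>k. ennreal (C * q ^ k))"
    by (simp only: g_int)
  also have "\<dots> = ennreal (\<Sum>k. C * q ^ k)"
    using q C by (intro suminf_ennreal2 summable_mult summable_geometric) auto
  also have "\<dots> < \<infinity>" by simp
  finally show ?thesis
    unfolding set_integrable_def by (intro integrableI_nonneg) (auto simp: indicator_def)
qed

subsection \<open>Cones at boundary points\<close>

text \<open>Near \<open>x\<close> the domain is the set where the defining function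
  \<open>\<phi>\<close> is negative. Since \<open>\<phi> x = 0\<close> and the gradient of
  \<open>\<phi>\<close> at \<open>x\<close> is a positive multiple of \<open>\<nu>\<close>, the sign
  of \<open>\<phi> y\<close> is that of \<open>(y - x) \<bullet> \<nu>\<close> as soon as this inner
  product exceeds the first-order error in absolute value.\<close>

lemma local_C1_graph_normal_cone:
  fixes \<Omega> :: "'a::euclidean_space set"
  assumes loc: "local_C1_graph \<Omega> x e \<gamma> g r" and x: "x \<in> frontier \<Omega>"
    and p: "p = g (x - (x \<bullet> e) *\<^sub>R e)" and \<nu>: "\<nu> = sgn (p - (p \<bullet> e) *\<^sub>R e - e)"
    and \<eta>: "0 < \<eta>"
  obtains \<delta> where "0 < \<delta>"
    and "\<And>y. norm (y - x) < \<delta> \<Longrightarrow> (y - x) \<bullet> \<nu> < - \<eta> * norm (y - x) \<Longrightarrow> y \<in> \<Omega>"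
    and "\<And>y. norm (y - x) < \<delta> \<Longrightarrow> \<eta> * norm (y - x) < (y - x) \<bullet> \<nu> \<Longrightarrow> y \<notin> \<Omega>"
proof -
  have e: "norm e = 1" and r: "0 < r" and G: "\<And>z. GDERIV \<gamma> z :> g z"
    and \<Omega>: "\<Omega> \<inter> ball x r = {y \<in> ball x r. \<gamma> (y - (y \<bullet> e) *\<^sub>R e) < y \<bullet> e}"
    using loc unfolding local_C1_graph_def by auto
  define \<phi> where "\<phi> y = \<gamma> (y - (y \<bullet> e) *\<^sub>R e) - y \<bullet> e" for y
  have \<Omega>_iff: "y \<in> \<Omega> \<longleftrightarrow> \<phi> y < 0" if "norm (y - x) < r" for y
  proof -
    have "y \<in> ball x r" using that by (simp add: dist_norm norm_minus_commute)
    moreover have "y \<in> \<Omega> \<inter> ball x r \<longleftrightarrow> y \<in> {y \<in> ball x r. \<gamma> (y - (y \<bullet> e) *\<^sub>R e) < y \<bullet> e}"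
      by (simp only: \<Omega>)
    ultimately show ?thesis by (simp add: \<phi>_def)
  qed
  define q where "q = p - (p \<bullet> e) *\<^sub>R e - e"
  \<comment> \<open>The component along \<open>e\<close> keeps the gradient \<open>q\<close> away
    from 0, whatever the slope of the graph.\<close>
  have "q \<bullet> e = - 1"
    using e by (simp add: q_def inner_diff_left dot_square_norm)
  then have q: "q \<noteq> 0" by force
  have qv: "q = norm q *\<^sub>R \<nu>"
    using q unfolding \<nu> q_def[symmetric] by (simp add: sgn_div_norm)
  have \<gamma>: "(\<gamma> has_derivative (\<lambda>h. h \<bullet> g z)) (at z)" for z
    using G by (simp add: gderiv_def)
  have "((\<lambda>y. \<gamma> (y - (y \<bullet> e) *\<^sub>R e)) has_derivative (\<lambda>h. (h - (h \<bullet> e) *\<^sub>R e) \<bullet> p)) (at y)"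
    if "p = g (y - (y \<bullet> e) *\<^sub>R e)" for y p
    unfolding that
    by (rule has_derivative_compose[where f="\<lambda>y. y - (y \<bullet> e) *\<^sub>R e", OF _ \<gamma>])
      (auto intro!: derivative_eq_intros)
  then have d: "(\<phi> has_derivative (\<lambda>h. (h - (h \<bullet> e) *\<^sub>R e) \<bullet> p - h \<bullet> e)) (at y)"
    if "p = g (y - (y \<bullet> e) *\<^sub>R e)" for y p
    unfolding \<phi>_def using that by (auto intro!: derivative_eq_intros)
  have cont: "continuous_on UNIV \<phi>"
    by (rule differentiable_imp_continuous_on)
      (use d in \<open>auto simp: differentiable_on_def differentiable_def\<close>)
  have "(\<lambda>h. (h - (h \<bullet> e) *\<^sub>R e) \<bullet> p - h \<bullet> e) = (\<lambda>h. h \<bullet> q)"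
    by (auto simp: q_def inner_simps inner_commute)
  then have dx: "(\<phi> has_derivative (\<lambda>h. h \<bullet> q)) (at x)"
    using d[OF p] by simp
  \<comment> \<open>A negative value would put \<open>x\<close> in the interior of
    \<open>\<Omega>\<close>, a positive one outside its closure; hence \<open>\<phi>\<close>
    vanishes at the frontier point.\<close>
  have "\<not> \<phi> x < 0"
  proof
    assume neg: "\<phi> x < 0"
    have "open ({y. \<phi> y < 0} \<inter> ball x r)"
      by (intro open_Int open_ball open_Collect_less cont continuous_on_const)
    moreover have "{y. \<phi> y < 0} \<inter> ball x r \<subseteq> \<Omega>"
      using \<Omega>_iff by (auto simp: dist_norm norm_minus_commute)
    ultimately have "x \<in> interior \<Omega>"
      using neg r by (intro interiorI) auto
    then show False
      using x by (simp add: frontier_def)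
  qed
  moreover have "\<not> 0 < \<phi> x"
  proof
    assume pos: "0 < \<phi> x"
    have "open ({y. 0 < \<phi> y} \<inter> ball x r)"
      by (intro open_Int open_ball open_Collect_less cont continuous_on_const)
    moreover have "{y. 0 < \<phi> y} \<inter> ball x r \<inter> \<Omega> = {}"
      using \<Omega>_iff by (force simp: dist_norm norm_minus_commute)
    moreover have "x \<in> {y. 0 < \<phi> y} \<inter> ball x r"
      using pos r by simp
    ultimately have "x \<notin> closure \<Omega>"
      using open_Int_closure_eq_empty by blast
    then show False
      using x by (simp add: frontier_def)
  qed
  ultimately have \<phi>x: "\<phi> x = 0" by simp
  \<comment> \<open>The tolerance carries the factor \<open>norm q\<close> because
    \<open>(y - x) \<bullet> q = norm q * ((y - x) \<bullet> \<nu>)\<close>; dividing by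
    \<open>norm q\<close> leaves the error \<open>\<eta> * norm (y - x)\<close>.\<close>
  from q \<eta> have "0 < \<eta> * norm q" by simp
  with dx obtain d where d: "0 < d"
    and dd: "\<And>y. norm (y - x) < d \<Longrightarrow>
      norm (\<phi> y - \<phi> x - (y - x) \<bullet> q) \<le> \<eta> * norm q * norm (y - x)"
    unfolding has_derivative_at_alt by meson
  have *: "(y - x) \<bullet> q = norm q * ((y - x) \<bullet> \<nu>)" for y
    by (subst qv) simp
  show thesis
  proof (rule that[of "min d r"])
    fix y assume y: "norm (y - x) < min d r"
    have b: "\<bar>\<phi> y - norm q * ((y - x) \<bullet> \<nu>)\<bar> \<le> norm q * (\<eta> * norm (y - x))"
      using dd[of y] y by (simp add: \<phi>x * mult_ac)
    {
      assume "(y - x) \<bullet> \<nu> < - \<eta> * norm (y - x)"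
      then have "norm q * ((y - x) \<bullet> \<nu>) < norm q * (- \<eta> * norm (y - x))"
        using q by (intro mult_strict_left_mono) auto
      then have "\<phi> y < 0" using b by simp
      then show "y \<in> \<Omega>" using \<Omega>_iff y by simp
    next
      assume "\<eta> * norm (y - x) < (y - x) \<bullet> \<nu>"
      then have "norm q * (\<eta> * norm (y - x)) < norm q * ((y - x) \<bullet> \<nu>)"
        using q by (intro mult_strict_left_mono) auto
      then have "0 < \<phi> y" using b by simp
      then show "y \<notin> \<Omega>" using \<Omega>_iff y by simp
    }
  qed (use d r in auto)
qed

section \<open>Integrals of the kernel over an open set, seen from outside its closure\<close>

text \<open>A ball of some radius \<open>d\<close> around \<open>x\<close> misses
  \<open>\<Omega>\<close>, so the kernel is dominated by the tail \<open>d \<le> norm z\<close> of a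
  power of the norm, reflected and translated by \<open>y \<mapsto> x - y\<close>.\<close>

lemma set_integrable_kernel:
  fixes \<Omega> :: "'a::euclidean_space set"
  assumes \<Omega>: "open \<Omega>" and x: "x \<notin> closure \<Omega>" and p: "real DIM('a) < p"
  shows "set_integrable lborel \<Omega> (\<lambda>y. 1 / norm (x - y) powr p)"
proof -
  obtain d where d: "0 < d" "ball x d \<subseteq> - closure \<Omega>"
    using x open_contains_ball[of "- closure \<Omega>"] by auto
  let ?f = "\<lambda>z::'a. indicator {z. d \<le> norm z} z *\<^sub>R norm z powr (- p)"
  have "integrable lborel ?f"
    using set_integrable_norm_powr[OF d(1) p] by (simp add: set_integrable_def)
  then have "integrable lborel (\<lambda>y. ?f (x + (- 1) *\<^sub>R y))"
    by (rule integrable_lborel_affine) simp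
  then have int: "integrable lborel (\<lambda>y. ?f (x - y))" by simp
  have [measurable]: "\<Omega> \<in> sets borel" using \<Omega> by simp
  show ?thesis
    unfolding set_integrable_def
  proof (rule Bochner_Integration.integrable_bound[OF int])
    have "d \<le> norm (x - y)" if "y \<in> \<Omega>" for y
    proof (rule ccontr)
      assume "\<not> d \<le> norm (x - y)"
      then have "y \<in> ball x d" by (simp add: dist_norm)
      then show False using d(2) that closure_subset by blast
    qed
    then show "AE y in lborel. norm (indicator \<Omega> y *\<^sub>R (1 / norm (x - y) powr p)) \<le> norm (?f (x - y))"
      by (intro AE_I2) (auto simp: indicator_def powr_minus_divide)
  qed measurable
qed

text \<open>Only the ball is kept, and on it the kernel is at least
  \<open>1 / R powr p\<close>.\<close>

lemma kernel_integral_ge: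
  fixes \<Omega> :: "'a::euclidean_space set"
  assumes \<Omega>: "open \<Omega>" and x: "x \<notin> closure \<Omega>" and p: "real DIM('a) < p"
    and \<rho>: "0 < \<rho>" and sub: "ball c \<rho> \<subseteq> \<Omega>" and R: "\<And>y. y \<in> ball c \<rho> \<Longrightarrow> norm (x - y) \<le> R"
  shows "\<rho> ^ DIM('a) * measure lborel (ball (0::'a) 1) / R powr p
    \<le> (LINT y:\<Omega>|lborel. 1 / norm (x - y) powr p)"
proof -
  have int: "set_integrable lborel \<Omega> (\<lambda>y. 1 / norm (x - y) powr p)"
    by (rule set_integrable_kernel) fact+
  have int_ball: "integrable lborel (\<lambda>y. (1 / R powr p) * indicator (ball c \<rho>) y)"
    by (intro integrable_mult_right integrable_real_indicator emeasure_lborel_ball_finite) simp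
  have "\<rho> ^ DIM('a) * measure lborel (ball (0::'a) 1) / R powr p = measure lborel (ball c \<rho>) / R powr p"
    using \<rho> content_ball_conv_unit_ball[of \<rho> c] by simp
  also have "\<dots> = (\<integral>y. (1 / R powr p) * indicator (ball c \<rho>) y \<partial>lborel)"
    by simp
  also have "\<dots> \<le> (\<integral>y. indicator \<Omega> y *\<^sub>R (1 / norm (x - y) powr p) \<partial>lborel)"
  proof (rule integral_mono[OF int_ball int[unfolded set_integrable_def]])
    fix y
    show "(1 / R powr p) * indicator (ball c \<rho>) y \<le> indicator \<Omega> y *\<^sub>R (1 / norm (x - y) powr p)"
    proof (cases "y \<in> ball c \<rho>")
      case True
      then have "y \<in> \<Omega>" using sub by blast
      then have "y \<noteq> x" using x closure_subset by blast
      moreover have "norm (x - y) powr p \<le> R powr p"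
        using R[OF True] p by (intro powr_mono2) auto
      ultimately show ?thesis
        using True \<open>y \<in> \<Omega>\<close> by (simp add: frac_le)
    next
      case False
      then show ?thesis by (simp add: indicator_def)
    qed
  qed
  finally show ?thesis by (simp add: set_lebesgue_integral_def)
qed

subsection \<open>The limit at the boundary\<close>

text \<open>
  If \<open>u\<close> grows too fast, the integrand is not integrable for any \<open>x\<close> near \<open>x0\<close>, and the left hand
  side is the junk value 0.
\<close>

lemma numerator_bound:
  fixes \<Omega> :: "'a::euclidean_space set"
  assumes \<Omega>: "open \<Omega>" and p: "real DIM('a) < p" and u: "continuous_on UNIV u"
    and \<delta>: "0 < \<delta>" and osc: "\<And>y. norm (y - x0) < \<delta> \<Longrightarrow> \<bar>u y - u x0\<bar> \<le> \<eta>"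
  obtains M where "0 \<le> M" and "\<And>x. x \<notin> closure \<Omega> \<Longrightarrow> norm (x - x0) < \<delta> / 2 \<Longrightarrow>
      \<bar>LINT y:\<Omega>|lborel. (u x - u y) / norm (x - y) powr p\<bar>
        \<le> 2 * \<eta> * (LINT y:\<Omega>|lborel. 1 / norm (x - y) powr p) + M"
proof -
  have \<eta>: "0 \<le> \<eta>" using osc[of x0] \<delta> by auto
  have [measurable]: "\<Omega> \<in> sets borel" using \<Omega> by simp
  have [measurable]: "u \<in> borel_measurable borel"
    using u by (rule borel_measurable_continuous_onI)
  define U where "U = \<bar>u x0\<bar> + \<eta>"
  have U: "0 \<le> U" using \<eta> by (simp add: U_def)
  \<comment> \<open>\<open>F\<close> will majorize the part of the numerator with \<open>y\<close>
    far from \<open>x0\<close>. Its kernel is centred at \<open>x0\<close> instead of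
    \<open>x\<close>, which makes \<open>M\<close> independent of \<open>x\<close>.\<close>
  define F where "F y = indicator (\<Omega> \<inter> {y. \<delta> \<le> norm (y - x0)}) y * ((U + \<bar>u y\<bar>) / norm (y - x0) powr p)" for y
  have F_meas[measurable]: "F \<in> borel_measurable borel"
    unfolding F_def[abs_def] by measurable
  have F_nonneg: "0 \<le> F y" for y
    using U by (simp add: F_def)
  have p0: "0 < p" using p by simp
  let ?k = "\<lambda>x y. 1 / norm (x - y) powr p"
  have kint: "integrable lborel (\<lambda>y. indicator \<Omega> y * ?k x y)" if "x \<notin> closure \<Omega>" for x
    using set_integrable_kernel[OF \<Omega> that p] by (simp add: set_integrable_def)
  have ne: "0 < norm (x - y)" if "x \<notin> closure \<Omega>" "y \<in> \<Omega>" for x y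
    using that closure_subset by fastforce
  \<comment> \<open>By the triangle inequality the distances from \<open>y\<close> to
    \<open>x\<close> and to \<open>x0\<close> differ by at most half of either admissible scale, so
    each is at most twice the other.\<close>
  have comp: "?k x y \<le> 2 powr p * ?k x0 y" "?k x0 y \<le> 2 powr p * ?k x y"
    if x: "x \<notin> closure \<Omega>" "norm (x - x0) < \<delta> / 2" and y: "y \<in> \<Omega>" "\<delta> \<le> norm (y - x0)" for x y
  proof -
    have pos: "0 < norm (x - y)" "0 < norm (x0 - y)"
      using ne[OF x(1) y(1)] y(2) \<delta> by (auto simp: norm_minus_commute)
    have "norm (x0 - y) \<le> 2 * norm (x - y)" "norm (x - y) \<le> 2 * norm (x0 - y)"
      using x(2) y(2) norm_triangle_ineq[of "x - y" "x0 - x"] norm_triangle_ineq[of "x - x0" "x0 - y"]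
      by (simp_all add: norm_minus_commute)
    then have "norm (x0 - y) powr p \<le> (2 * norm (x - y)) powr p"
      "norm (x - y) powr p \<le> (2 * norm (x0 - y)) powr p"
      using p0 by (auto intro!: powr_mono2)
    then show "?k x y \<le> 2 powr p * ?k x0 y" "?k x0 y \<le> 2 powr p * ?k x y"
      using pos by (auto simp: powr_mult field_simps)
  qed
  define M where "M = 2 powr p * (\<integral>y. F y \<partial>lborel)"
  have M: "0 \<le> M"
    unfolding M_def by (intro mult_nonneg_nonneg Bochner_Integration.integral_nonneg F_nonneg) auto
  show thesis
  proof (rule that[OF M])
    fix x assume x: "x \<notin> closure \<Omega>" "norm (x - x0) < \<delta> / 2"
    let ?h = "\<lambda>y. indicator \<Omega> y * ((u x - u y) * ?k x y)"
    have D: "0 \<le> (\<integral>y. indicator \<Omega> y * ?k x y \<partial>lborel)"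
      by (intro Bochner_Integration.integral_nonneg) auto
    have ux: "\<bar>u x - u x0\<bar> \<le> \<eta>"
      using osc[of x] x \<delta> by simp
    have "\<bar>\<integral>y. ?h y \<partial>lborel\<bar> \<le> 2 * \<eta> * (\<integral>y. indicator \<Omega> y * ?k x y \<partial>lborel) + M"
    proof (cases "integrable lborel ?h")
      case False
      then show ?thesis
        using \<eta> M D by (simp add: not_integrable_integral_eq)
    next
      case True
      \<comment> \<open>Integrability of \<open>?h\<close> for this one \<open>x\<close> forces that
        of \<open>F\<close>: subtracting the integrable term with \<open>u x\<close> leaves the term
        with \<open>u y\<close>, and \<open>comp\<close> transfers it to the kernel centred at
        \<open>x0\<close>.\<close>
      have "integrable lborel (\<lambda>y. u x * (indicator \<Omega> y * ?k x y) - ?h y)"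
        by (intro Bochner_Integration.integrable_diff integrable_mult_right kint x True)
      then have "integrable lborel (\<lambda>y. u y * (indicator \<Omega> y * ?k x y))"
        by (rule Bochner_Integration.integrable_cong[THEN iffD1, rotated -1])
          (auto simp: algebra_simps diff_divide_distrib)
      then have "integrable lborel (\<lambda>y. 2 powr p * (U * (indicator \<Omega> y * ?k x y)
          + \<bar>u y * (indicator \<Omega> y * ?k x y)\<bar>))"
        by (intro Bochner_Integration.integrable_add integrable_mult_right kint x integrable_abs)
      then have Fint: "integrable lborel F"
      proof (rule Bochner_Integration.integrable_bound)
        show "AE y in lborel. norm (F y) \<le> norm (2 powr p * (U * (indicator \<Omega> y * ?k x y)
          + \<bar>u y * (indicator \<Omega> y * ?k x y)\<bar>))"
        proof (rule AE_I2)
          fix y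
          show "norm (F y) \<le> norm (2 powr p * (U * (indicator \<Omega> y * ?k x y)
            + \<bar>u y * (indicator \<Omega> y * ?k x y)\<bar>))"
          proof (cases "y \<in> \<Omega> \<inter> {y. \<delta> \<le> norm (y - x0)}")
            case True
            then have "(U + \<bar>u y\<bar>) * ?k x0 y \<le> (U + \<bar>u y\<bar>) * (2 powr p * ?k x y)"
              using U by (intro mult_left_mono comp x) auto
            moreover have "norm (F y) = (U + \<bar>u y\<bar>) * ?k x0 y"
              using True U by (simp add: F_def norm_minus_commute)
            moreover have "norm (2 powr p * (U * (indicator \<Omega> y * ?k x y)
                + \<bar>u y * (indicator \<Omega> y * ?k x y)\<bar>)) = (U + \<bar>u y\<bar>) * (2 powr p * ?k x y)"
              using True U by (simp add: abs_mult algebra_simps add_divide_distrib)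
            ultimately show ?thesis by simp
          qed (simp add: F_def)
        qed
      qed simp
      have "\<bar>\<integral>y. ?h y \<partial>lborel\<bar> \<le> (\<integral>y. \<bar>?h y\<bar> \<partial>lborel)"
        using integral_norm_bound[of lborel ?h] by simp
      also have "\<dots> \<le> (\<integral>y. 2 * \<eta> * (indicator \<Omega> y * ?k x y) + 2 powr p * F y \<partial>lborel)"
      proof (rule integral_mono)
        show "integrable lborel (\<lambda>y. \<bar>?h y\<bar>)"
          using True by (rule integrable_abs)
        show "integrable lborel (\<lambda>y. 2 * \<eta> * (indicator \<Omega> y * ?k x y) + 2 powr p * F y)"
          by (intro Bochner_Integration.integrable_add integrable_mult_right kint x Fint)
        fix y
        show "\<bar>?h y\<bar> \<le> 2 * \<eta> * (indicator \<Omega> y * ?k x y) + 2 powr p * F y"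
        proof (cases "y \<in> \<Omega>")
          case y: True
          show ?thesis
          proof (cases "norm (y - x0) < \<delta>")
            case True
            have "\<bar>u x - u y\<bar> \<le> 2 * \<eta>"
              using ux osc[OF True] by linarith
            then have "\<bar>u x - u y\<bar> * ?k x y \<le> 2 * \<eta> * ?k x y"
              by (intro mult_right_mono) auto
            then show ?thesis
              using y F_nonneg[of y] by (simp add: abs_mult add_increasing2)
          next
            case False
            \<comment> \<open>Far from \<open>x0\<close> the oscillation gives no control of
              \<open>u y\<close>; only \<open>\<bar>u x\<bar> \<le> U\<close> is used, and the
              kernel is recentred.\<close>
            have "\<bar>u x - u y\<bar> * ?k x y \<le> (U + \<bar>u y\<bar>) * (2 powr p * ?k x0 y)"
              using ux y False U by (intro mult_mono comp x) (auto simp: U_def)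
            moreover have "F y = (U + \<bar>u y\<bar>) * ?k x0 y"
              using y False by (simp add: F_def norm_minus_commute)
            moreover have "0 \<le> 2 * \<eta> * ?k x y" using \<eta> by simp
            ultimately show ?thesis
              using y by (simp add: abs_mult mult_ac add_increasing)
          qed
        qed (use F_nonneg in simp)
      qed
      also have "\<dots> = 2 * \<eta> * (\<integral>y. indicator \<Omega> y * ?k x y \<partial>lborel) + M"
        unfolding M_def integral_mult_right_zero[symmetric]
        by (intro Bochner_Integration.integral_add integrable_mult_right kint x Fint)
      finally show ?thesis .
    qed
    then show "\<bar>LINT y:\<Omega>|lborel. (u x - u y) / norm (x - y) powr p\<bar>
        \<le> 2 * \<eta> * (LINT y:\<Omega>|lborel. 1 / norm (x - y) powr p) + M"
      by (simp add: set_lebesgue_integral_def)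
  qed
qed

text \<open>Dividing the numerator bound by the denominator \<open>D x\<close> leaves a small
  constant plus \<open>M / D x\<close>, and \<open>D x\<close> tends to infinity at the boundary at
  least like \<open>norm (x - x0) powr (- 2 * s)\<close>.\<close>

lemma renorm_nonlocal_normal_deriv_tendsto_0:
  fixes \<Omega> :: "'a::euclidean_space set"
  assumes dom: "C1_domain \<Omega>" and u: "continuous_on UNIV u" and s: "0 < s"
    and x0: "x0 \<in> frontier \<Omega>"
  shows "(renorm_nonlocal_normal_deriv s \<Omega> u \<longlongrightarrow> 0) (at x0 within - closure \<Omega>)"
proof -
  define p where "p = real DIM('a) + 2 * s"
  have p: "real DIM('a) < p" using s by (simp add: p_def)
  have \<Omega>: "open \<Omega>" using dom by (simp add: C1_domain_def)
  obtain e \<gamma> g r where loc: "local_C1_graph \<Omega> x0 e \<gamma> g r"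
    using dom x0 unfolding C1_domain_def by blast
  define \<nu> where "\<nu> = sgn (g (x0 - (x0 \<bullet> e) *\<^sub>R e) - (g (x0 - (x0 \<bullet> e) *\<^sub>R e) \<bullet> e) *\<^sub>R e - e)"
  have "exterior_unit_normal \<Omega> x0 \<nu>"
    unfolding exterior_unit_normal_def Let_def \<nu>_def using loc by blast
  then have \<nu>: "norm \<nu> = 1"
    by (rule exterior_unit_normal_norm)
  obtain d where d: "0 < d"
    and cone: "\<And>y. norm (y - x0) < d \<Longrightarrow> (y - x0) \<bullet> \<nu> < - (1/4) * norm (y - x0) \<Longrightarrow> y \<in> \<Omega>"
  proof (rule local_C1_graph_normal_cone[OF loc x0 refl \<nu>_def])
    show "0 < (1/4::real)" by simp
  qed (use that in blast)
  define D where "D x = (LINT y:\<Omega>|lborel. 1 / norm (x - y) powr p)" for x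
  define K where "K = (1/4) ^ DIM('a) * measure lborel (ball (0::'a) 1) / 2 powr p"
  have K: "0 < K"
    using content_ball_pos[of 1 "0::'a"] by (simp add: K_def)
  have D_ge: "K * norm (x - x0) powr (- 2 * s) \<le> D x"
    if x: "x \<notin> closure \<Omega>" "norm (x - x0) < d" for x
  proof -
    define \<rho> where "\<rho> = norm (x - x0)"
    have "x \<noteq> x0" using x x0 by (auto simp: frontier_def)
    then have \<rho>: "0 < \<rho>" by (simp add: \<rho>_def)
    \<comment> \<open>The ball of radius \<open>\<rho> / 4\<close> around \<open>?c\<close> lies in
      the inner cone of aperture constant 1/4: there \<open>(y - x0) \<bullet> \<nu>\<close> is
      below \<open>- \<rho> / 4\<close>, while \<open>norm (y - x0)\<close> is at most
      \<open>3 / 4 * \<rho>\<close>.\<close>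
    let ?c = "x0 - (\<rho> / 2) *\<^sub>R \<nu>"
    have in_ball: "norm (y - x0) \<le> 3 / 4 * \<rho>" "(y - x0) \<bullet> \<nu> < - (1/4) * \<rho>"
      if "y \<in> ball ?c (\<rho> / 4)" for y
    proof -
      have y: "norm (y - ?c) < \<rho> / 4"
        using that by (simp add: dist_norm norm_minus_commute)
      show "norm (y - x0) \<le> 3 / 4 * \<rho>"
        using norm_triangle_ineq[of "y - ?c" "- (\<rho> / 2) *\<^sub>R \<nu>"] y \<nu> \<rho> by simp
      have "(y - ?c) \<bullet> \<nu> < \<rho> / 4"
        using norm_cauchy_schwarz[of "y - ?c" \<nu>] \<nu> y by simp
      moreover have "(y - ?c) \<bullet> \<nu> = (y - x0) \<bullet> \<nu> + \<rho> / 2"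
        using \<nu> by (simp add: inner_simps dot_square_norm)
      ultimately show "(y - x0) \<bullet> \<nu> < - (1/4) * \<rho>" by simp
    qed
    have "(\<rho> / 4) ^ DIM('a) * measure lborel (ball (0::'a) 1) / (2 * \<rho>) powr p \<le> D x"
      unfolding D_def
    proof (rule kernel_integral_ge[OF \<Omega> x(1) p])
      show "ball ?c (\<rho> / 4) \<subseteq> \<Omega>"
      proof
        fix y assume y: "y \<in> ball ?c (\<rho> / 4)"
        show "y \<in> \<Omega>"
          using in_ball[OF y] \<rho> x(2) by (intro cone) (auto simp flip: \<rho>_def)
      qed
      fix y assume y: "y \<in> ball ?c (\<rho> / 4)"
      show "norm (x - y) \<le> 2 * \<rho>"
        using in_ball(1)[OF y] norm_triangle_ineq[of "x - x0" "x0 - y"] \<rho>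
        by (simp add: norm_minus_commute[of x0 y] flip: \<rho>_def)
    qed (use \<rho> in simp)
    also have "(\<rho> / 4) ^ DIM('a) * measure lborel (ball (0::'a) 1) / (2 * \<rho>) powr p
        = K * (\<rho> powr real DIM('a) / \<rho> powr p)"
      using \<rho> by (simp add: K_def powr_mult power_divide powr_realpow mult_ac)
    also have "\<rho> powr real DIM('a) / \<rho> powr p = \<rho> powr (- 2 * s)"
      by (simp add: p_def powr_diff[symmetric])
    finally show ?thesis unfolding \<rho>_def .
  qed
  show ?thesis
  proof (rule tendstoI)
    fix \<epsilon> :: real assume \<epsilon>: "0 < \<epsilon>"
    have "isCont u x0"
      using u by (simp add: continuous_on_eq_continuous_at)
    \<comment> \<open>The bound on the numerator doubles the oscillation, so
      \<open>\<epsilon> / 8\<close> contributes \<open>\<epsilon> / 4\<close> to the quotient; the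
      far part contributes another \<open>\<epsilon> / 4\<close>.\<close>
    then obtain \<delta> where \<delta>: "0 < \<delta>" and osc: "\<And>y. norm (y - x0) < \<delta> \<Longrightarrow> \<bar>u y - u x0\<bar> \<le> \<epsilon> / 8"
      using \<epsilon> unfolding continuous_at_eps_delta dist_norm real_norm_def
      by (meson divide_pos_pos less_imp_le zero_less_numeral)
    obtain M where M: "0 \<le> M" and num: "\<And>x. x \<notin> closure \<Omega> \<Longrightarrow> norm (x - x0) < \<delta> / 2 \<Longrightarrow>
        \<bar>LINT y:\<Omega>|lborel. (u x - u y) / norm (x - y) powr p\<bar> \<le> 2 * (\<epsilon> / 8) * D x + M"
      using numerator_bound[OF \<Omega> p u \<delta> osc] unfolding D_def by blast
    \<comment> \<open>The limit value is 0, because \<open>0 powr (2 * s) = 0\<close>.\<close>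
    have "((\<lambda>x. M / K * norm (x - x0) powr (2 * s)) \<longlongrightarrow> M / K * norm (x0 - x0) powr (2 * s))
        (at x0 within - closure \<Omega>)"
      using s by (intro tendsto_intros tendsto_powr') auto
    then have small: "\<forall>\<^sub>F x in at x0 within - closure \<Omega>. M / K * norm (x - x0) powr (2 * s) < \<epsilon> / 4"
      using s \<epsilon> by (intro order_tendstoD) auto
    have near: "\<forall>\<^sub>F x in at x0 within - closure \<Omega>. x \<notin> closure \<Omega> \<and> x \<noteq> x0 \<and> norm (x - x0) < min d (\<delta> / 2)"
      using d \<delta> by (auto simp: eventually_at dist_norm intro!: exI[of _ "min d (\<delta> / 2)"])
    show "\<forall>\<^sub>F x in at x0 within - closure \<Omega>. dist (renorm_nonlocal_normal_deriv s \<Omega> u x) 0 < \<epsilon>"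
      using small near
    proof eventually_elim
      case (elim x)
      then have x: "x \<notin> closure \<Omega>" "norm (x - x0) < \<delta> / 2" "norm (x - x0) < d" and pos: "0 < norm (x - x0)"
        by auto
      have low: "0 < K * norm (x - x0) powr (- 2 * s)" using K pos by simp
      have Dpos: "0 < D x" using low D_ge[OF x(1,3)] by linarith
      have "\<bar>renorm_nonlocal_normal_deriv s \<Omega> u x\<bar> =
          \<bar>LINT y:\<Omega>|lborel. (u x - u y) / norm (x - y) powr p\<bar> / D x"
        using Dpos by (simp add: renorm_nonlocal_normal_deriv_def D_def p_def abs_divide)
      also have "\<dots> \<le> (2 * (\<epsilon> / 8) * D x + M) / D x"
        using num[OF x(1,2)] Dpos by (intro divide_right_mono) auto
      also have "\<dots> = \<epsilon> / 4 + M / D x"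
        using Dpos by (simp add: add_divide_distrib)
      also have "M / D x \<le> M / (K * norm (x - x0) powr (- 2 * s))"
        using D_ge[OF x(1,3)] low M by (intro divide_left_mono) auto
      also have "M / (K * norm (x - x0) powr (- 2 * s)) = M / K * norm (x - x0) powr (2 * s)"
        using pos by (simp add: powr_minus_divide)
      finally have "\<bar>renorm_nonlocal_normal_deriv s \<Omega> u x\<bar> \<le> \<epsilon> / 4 + M / K * norm (x - x0) powr (2 * s)"
        by simp
      then show ?case
        using elim(1) \<epsilon> unfolding dist_real_def diff_0_right by linarith
    qed
  qed
qed

subsection \<open>Half-space integrals\<close>

lemma integrable_lborel_powr_bound:
  fixes f :: "'a::euclidean_space \<Rightarrow> real"
  assumes f[measurable]: "f \<in> borel_measurable borel" and r: "0 < r" and q: "real DIM('a) < q"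
    and near: "\<And>z. norm z < r \<Longrightarrow> f z = 0"
    and far: "\<And>z. r \<le> norm z \<Longrightarrow> \<bar>f z\<bar> \<le> C * norm z powr (- q)"
  shows "integrable lborel f"
proof (rule Bochner_Integration.integrable_bound)
  show "integrable lborel (\<lambda>z::'a. C * (indicator {z. r \<le> norm z} z *\<^sub>R norm z powr (- q)))"
    using set_integrable_norm_powr[OF r q] unfolding set_integrable_def by (rule integrable_mult_right)
  show "AE z in lborel. norm (f z) \<le> norm (C * (indicator {z. r \<le> norm z} z *\<^sub>R norm z powr (- q)))"
  proof (rule AE_I2)
    fix z
    show "norm (f z) \<le> norm (C * (indicator {z. r \<le> norm z} z *\<^sub>R norm z powr (- q)))"
      using near[of z] far[of z] by (cases "norm z < r") (auto intro: order_trans[OF _ abs_ge_self])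
  qed
qed simp

text \<open>The reflection along \<open>\<nu> - \<nu>'\<close> exchanges the two unit vectors and
  preserves both the norm and Lebesgue measure. The two arguments of \<open>F\<close> cover the
  half-space integrals, which see \<open>z\<close> only through \<open>z \<bullet> \<nu>\<close> and
  \<open>norm z\<close>.\<close>

lemma integral_lborel_rotate:
  fixes \<nu> \<nu>' :: "'a::euclidean_space" and F :: "real \<Rightarrow> real \<Rightarrow> real"
  assumes \<nu>: "norm \<nu> = 1" "norm \<nu>' = 1"
    and F: "(\<lambda>z. F (z \<bullet> \<nu>) (norm z)) \<in> borel_measurable borel"
  shows "(\<integral>z. F (z \<bullet> \<nu>) (norm z) \<partial>lborel) = (\<integral>z. F (z \<bullet> \<nu>') (norm z) \<partial>lborel)"
proof -
  define c where "c = \<nu> - \<nu>'"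
  define T where "T z = z - (2 * (z \<bullet> c) / (c \<bullet> c)) *\<^sub>R c" for z
  have T: "orthogonal_transformation T"
    unfolding T_def[abs_def] by (rule orthogonal_transformation_reflection)
  have "\<nu> \<bullet> \<nu> = 1" "\<nu>' \<bullet> \<nu>' = 1"
    using \<nu> by (simp_all add: dot_square_norm)
  then have cc: "c \<bullet> c = 2 * (\<nu> \<bullet> c)"
    by (simp add: c_def inner_simps inner_commute)
  have "T z \<bullet> \<nu> = z \<bullet> \<nu>'" for z
  proof (cases "c = 0")
    case True
    then show ?thesis by (simp add: T_def c_def)
  next
    case False
    then have "c \<bullet> c \<noteq> 0" by simp
    then have "2 * (\<nu> \<bullet> c) / (c \<bullet> c) = 1" using cc by simp
    have "T z \<bullet> \<nu> = z \<bullet> \<nu> - (2 * (\<nu> \<bullet> c) / (c \<bullet> c)) * (z \<bullet> c)"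
      by (simp add: T_def inner_simps inner_commute)
    also have "\<dots> = z \<bullet> \<nu>'"
      unfolding \<open>2 * (\<nu> \<bullet> c) / (c \<bullet> c) = 1\<close> by (simp add: c_def inner_simps)
    finally show ?thesis .
  qed
  then show ?thesis
    using integral_lborel_orthogonal_transformation[OF T F] orthogonal_transformation_norm[OF T] by simp
qed

text \<open>The part of \<open>a\<close> orthogonal to \<open>\<nu>\<close> drops out by the reflection fixing \<open>\<nu>\<close>.\<close>

lemma half_space_integral_inner:
  fixes \<nu> a :: "'a::euclidean_space"
  assumes \<nu>: "norm \<nu> = 1" and p: "real DIM('a) + 1 < p"
  shows "integrable lborel (\<lambda>z. indicator {z. 1 < z \<bullet> \<nu>} z * ((z \<bullet> a) / norm z powr p))" (is "integrable _ (?f a)")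
    and "(\<integral>z. indicator {z. 1 < z \<bullet> \<nu>} z * ((z \<bullet> a) / norm z powr p) \<partial>lborel) =
      (a \<bullet> \<nu>) * (\<integral>z. indicator {z. 1 < z \<bullet> \<nu>} z * ((z \<bullet> \<nu>) / norm z powr p) \<partial>lborel)"
proof -
  have int: "integrable lborel (?f a)" for a
  proof (rule integrable_lborel_powr_bound[where r = 1 and q = "p - 1" and C = "norm a"])
    show "?f a \<in> borel_measurable borel" by measurable
    fix z :: 'a
    show "?f a z = 0" if "norm z < 1"
      using that norm_cauchy_schwarz[of z \<nu>] \<nu> by (simp add: indicator_def)
    show "\<bar>?f a z\<bar> \<le> norm a * norm z powr (- (p - 1))" if z: "1 \<le> norm z"
    proof -
      have "\<bar>?f a z\<bar> \<le> \<bar>z \<bullet> a\<bar> / norm z powr p"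
        by (simp add: indicator_def)
      also have "\<dots> \<le> norm z * norm a / norm z powr p"
        by (intro divide_right_mono Cauchy_Schwarz_ineq2) simp
      also have "\<dots> = norm a * norm z powr (- (p - 1))"
        using z by (simp add: powr_minus_divide powr_diff)
      finally show ?thesis .
    qed
  qed (use p in auto)
  then show "integrable lborel (?f a)" .
  \<comment> \<open>Negating the reflection gives the map that keeps the component along
    \<open>\<nu>\<close> and reverses the orthogonal part. Substituting it expresses the integral
    for \<open>a\<close> as \<open>2 * (a \<bullet> \<nu>)\<close> times the integral for
    \<open>\<nu>\<close>, minus itself.\<close>
  define S where "S z = - (z - (2 * (z \<bullet> \<nu>) / (\<nu> \<bullet> \<nu>)) *\<^sub>R \<nu>)" for z
  have S: "orthogonal_transformation S"
    unfolding S_def[abs_def] orthogonal_transformation_neg by (rule orthogonal_transformation_reflection)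
  have \<nu>\<nu>: "\<nu> \<bullet> \<nu> = 1" using \<nu> by (simp add: dot_square_norm)
  have Sn: "S z \<bullet> \<nu> = z \<bullet> \<nu>" and Sa: "S z \<bullet> a = 2 * (a \<bullet> \<nu>) * (z \<bullet> \<nu>) - z \<bullet> a" for z
    using \<nu>\<nu> by (simp_all add: S_def inner_simps inner_commute)
  have "(\<integral>z. ?f a z \<partial>lborel) = (\<integral>z. ?f a (S z) \<partial>lborel)"
    by (rule integral_lborel_orthogonal_transformation[OF S, symmetric]) measurable
  also have "\<dots> = (\<integral>z. 2 * (a \<bullet> \<nu>) * ?f \<nu> z - ?f a z \<partial>lborel)"
    by (intro Bochner_Integration.integral_cong)
      (auto simp: indicator_def Sn Sa orthogonal_transformation_norm[OF S] diff_divide_distrib)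
  also have "\<dots> = (\<integral>z. 2 * (a \<bullet> \<nu>) * ?f \<nu> z \<partial>lborel) - (\<integral>z. ?f a z \<partial>lborel)"
    by (intro Bochner_Integration.integral_diff integrable_mult_right int)
  also have "(\<integral>z. 2 * (a \<bullet> \<nu>) * ?f \<nu> z \<partial>lborel) = 2 * (a \<bullet> \<nu>) * (\<integral>z. ?f \<nu> z \<partial>lborel)"
    by (rule integral_mult_right_zero)
  finally show "(\<integral>z. ?f a z \<partial>lborel) = (a \<bullet> \<nu>) * (\<integral>z. ?f \<nu> z \<partial>lborel)"
    by simp
qed

text \<open>The kernel bound is applied at the point 0, which lies off the closed half-space, with
  the ball of radius 1/2 around \<open>2 *\<^sub>R \<nu>\<close>.\<close>

lemma half_space_integral_pos:
  fixes \<nu> :: "'a::euclidean_space"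
  assumes \<nu>: "norm \<nu> = 1" and p: "real DIM('a) < p"
  shows "0 < (\<integral>z. indicator {z. 1 < z \<bullet> \<nu>} z * (1 / norm z powr p) \<partial>lborel)"
proof -
  let ?H = "{z. 1 < z \<bullet> \<nu>}"
  have \<nu>\<nu>: "\<nu> \<bullet> \<nu> = 1" using \<nu> by (simp add: dot_square_norm)
  have H: "open ?H"
    by (intro open_Collect_less continuous_intros)
  have "closure ?H \<subseteq> {z. 1 \<le> z \<bullet> \<nu>}"
    by (intro closure_minimal closed_Collect_le continuous_intros) auto
  then have x: "0 \<notin> closure ?H" by auto
  have in_ball: "3 / 2 < z \<bullet> \<nu>" "norm z \<le> 3" if "z \<in> ball (2 *\<^sub>R \<nu>) (1 / 2)" for z
  proof -
    have z: "norm (z - 2 *\<^sub>R \<nu>) < 1 / 2"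
      using that by (simp add: dist_norm norm_minus_commute)
    have "\<bar>(z - 2 *\<^sub>R \<nu>) \<bullet> \<nu>\<bar> < 1 / 2"
      using Cauchy_Schwarz_ineq2[of "z - 2 *\<^sub>R \<nu>" \<nu>] z \<nu> by simp
    moreover have "(z - 2 *\<^sub>R \<nu>) \<bullet> \<nu> = z \<bullet> \<nu> - 2"
      using \<nu>\<nu> by (simp add: inner_simps)
    ultimately show "3 / 2 < z \<bullet> \<nu>" by linarith
    show "norm z \<le> 3"
      using norm_triangle_ineq[of "z - 2 *\<^sub>R \<nu>" "2 *\<^sub>R \<nu>"] z \<nu> by simp
  qed
  have "0 < (1 / 2) ^ DIM('a) * measure lborel (ball (0::'a) 1) / 3 powr p"
    using content_ball_pos[of 1 "0::'a"] by simp
  also have "\<dots> \<le> (LINT z:?H|lborel. 1 / norm (0 - z) powr p)"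
    by (rule kernel_integral_ge[OF H x p, of "1 / 2" "2 *\<^sub>R \<nu>"]) (use in_ball in force)+
  finally show ?thesis by (simp add: set_lebesgue_integral_def)
qed

text \<open>On the half-space the factor \<open>z \<bullet> \<nu>\<close> exceeds 1, so the
  integrand dominates the one of \<open>half_space_integral_pos\<close>.\<close>

lemma half_space_integral_inner_pos:
  fixes \<nu> :: "'a::euclidean_space"
  assumes \<nu>: "norm \<nu> = 1" and p: "real DIM('a) + 1 < p"
  shows "0 < (\<integral>z. indicator {z. 1 < z \<bullet> \<nu>} z * ((z \<bullet> \<nu>) / norm z powr p) \<partial>lborel)"
proof -
  have "0 < (\<integral>z. indicator {z. 1 < z \<bullet> \<nu>} z * (1 / norm z powr p) \<partial>lborel)"
    using p by (intro half_space_integral_pos \<nu>) simp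
  also have "\<dots> \<le> (\<integral>z. indicator {z. 1 < z \<bullet> \<nu>} z * ((z \<bullet> \<nu>) / norm z powr p) \<partial>lborel)"
  proof (rule Bochner_Integration.integral_mono')
    show "integrable lborel (\<lambda>z. indicator {z. 1 < z \<bullet> \<nu>} z * ((z \<bullet> \<nu>) / norm z powr p))"
      by (rule half_space_integral_inner(1)[OF assms])
  qed (auto simp: indicator_def divide_right_mono)
  finally show ?thesis .
qed

text \<open>One-sided limits are tested on sequences in the interval from \<open>a\<close> to
  \<open>b\<close>, where the sequential theorem applies.\<close>

lemma integral_dominated_convergence_at_right:
  fixes s :: "real \<Rightarrow> 'b \<Rightarrow> real"
  assumes "f \<in> borel_measurable M" "\<And>t. s t \<in> borel_measurable M" "integrable M w" "a < b"
    and lim: "AE x in M. ((\<lambda>t. s t x) \<longlongrightarrow> f x) (at_right a)"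
    and bound: "\<And>t. a < t \<Longrightarrow> t < b \<Longrightarrow> AE x in M. norm (s t x) \<le> w x"
  shows "((\<lambda>t. \<integral>x. s t x \<partial>M) \<longlongrightarrow> (\<integral>x. f x \<partial>M)) (at_right a)"
proof (rule tendsto_at_right_sequentially[OF \<open>a < b\<close>])
  fix S :: "nat \<Rightarrow> real"
  assume S: "\<And>n. a < S n" "\<And>n. S n < b" "S \<longlonglongrightarrow> a"
  have S_right: "filterlim S (at_right a) sequentially"
    using S by (auto simp: filterlim_at intro!: always_eventually)
  have "AE x in M. (\<lambda>n. s (S n) x) \<longlonglongrightarrow> f x"
    by (rule eventually_mono[OF lim]) (rule filterlim_compose[OF _ S_right])
  then show "(\<lambda>n. \<integral>x. s (S n) x \<partial>M) \<longlonglongrightarrow> (\<integral>x. f x \<partial>M)"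
    using assms S by (intro integral_dominated_convergence[where w = w]) auto
qed

text \<open>This discards the boundary \<open>z \<bullet> \<nu> = 1\<close> of the limiting
  half-space, where the cones do not decide whether the rescaled points lie in the domain.\<close>

lemma AE_lborel_hyperplane:
  fixes \<nu> :: "'a::euclidean_space"
  assumes "\<nu> \<noteq> 0"
  shows "AE z in lborel. z \<bullet> \<nu> \<noteq> c"
proof -
  have "negligible {z. \<nu> \<bullet> z = c}"
    using assms by (intro negligible_hyperplane) simp
  moreover have "{z. \<nu> \<bullet> z = c} \<in> sets lborel"
    by (simp add: closed_hyperplane)
  ultimately have "{z. \<nu> \<bullet> z = c} \<in> null_sets lborel"
    by (simp add: negligible_iff_null_sets null_sets_completion_iff)
  then show ?thesis
    by (rule AE_I') (auto simp: inner_commute)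
qed

subsection \<open>The normal derivative\<close>

text \<open>Mean value inequality on the ball of radius \<open>R\<close> around \<open>x\<close>,
  where the Hoelder condition bounds the gradient by its value at the centre plus
  \<open>C * R powr \<alpha>\<close>.\<close>

lemma C1_Holder_increment_bound:
  fixes u :: "'a::euclidean_space \<Rightarrow> real"
  assumes G: "\<And>x. GDERIV u x :> g x" and Hol: "\<And>x y. norm (g x - g y) \<le> C * dist x y powr \<alpha>"
    and C: "0 \<le> C" and \<alpha>: "0 \<le> \<alpha>" and y: "norm (y - x) \<le> R" "norm (z - x) \<le> R"
  shows "\<bar>u y - u z\<bar> \<le> (norm (g x) + C * R powr \<alpha>) * norm (y - z)"
proof -
  have "norm (u y - u z) \<le> (norm (g x) + C * R powr \<alpha>) * norm (y - z)"
  proof (rule differentiable_bound[OF convex_cball])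
    show "(u has_derivative (\<lambda>h. h \<bullet> g w)) (at w within cball x R)" for w
      using G[of w] unfolding gderiv_def by (rule has_derivative_at_withinI)
    show "onorm (\<lambda>h. h \<bullet> g w) \<le> norm (g x) + C * R powr \<alpha>" if w: "w \<in> cball x R" for w
    proof (rule onorm_le)
      fix h
      have "norm (g w) \<le> norm (g x) + norm (g w - g x)"
        using norm_triangle_ineq[of "g x" "g w - g x"] by simp
      also have "norm (g w - g x) \<le> C * dist w x powr \<alpha>" by (rule Hol)
      also have "\<dots> \<le> C * R powr \<alpha>"
        using w C \<alpha> by (intro mult_left_mono powr_mono2) (auto simp: dist_commute)
      finally have "norm (g w) \<le> norm (g x) + C * R powr \<alpha>" by simp
      then show "norm (h \<bullet> g w) \<le> (norm (g x) + C * R powr \<alpha>) * norm h"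
        using Cauchy_Schwarz_ineq2[of h "g w"] mult_left_mono[of "norm (g w)" _ "norm h"]
        by (fastforce simp: mult.commute)
    qed
    show "y \<in> cball x R" "z \<in> cball x R"
      using y by (auto simp: dist_norm norm_minus_commute)
  qed
  then show ?thesis by simp
qed

lemma GDERIV_dir:
  assumes "GDERIV u x :> a"
  shows "((\<lambda>t. u (x + t *\<^sub>R w)) has_real_derivative w \<bullet> a) (at 0)"
proof -
  have "((\<lambda>t. x + t *\<^sub>R w) has_derivative (\<lambda>t. t *\<^sub>R w)) (at 0)"
    by (auto intro!: derivative_eq_intros)
  then have "((\<lambda>t. u (x + t *\<^sub>R w)) has_derivative (\<lambda>t. (t *\<^sub>R w) \<bullet> a)) (at 0)"
    by (rule has_derivative_compose) (use assms in \<open>simp add: gderiv_def\<close>)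
  then show ?thesis
    by (simp add: has_field_derivative_def mult_commute_abs)
qed

text \<open>
  Substituting \<open>y = x + \<epsilon> *\<^sub>R \<nu> - \<epsilon> *\<^sub>R z\<close> turns both integrals, up to the common factor
  \<open>\<epsilon> powr (- 2 * s)\<close>, into integrals over the blow-up of \<open>\<Omega>\<close> at \<open>x\<close>, which converges to the
  half-space \<open>1 < z \<bullet> \<nu>\<close>.
\<close>

lemma renorm_nonlocal_normal_deriv_rescale:
  fixes \<Omega> :: "'a::euclidean_space set"
  assumes [measurable]: "\<Omega> \<in> sets borel" "u \<in> borel_measurable borel" and \<epsilon>: "0 < \<epsilon>"
    and p: "p = real DIM('a) + 2 * s"
  shows "renorm_nonlocal_normal_deriv s \<Omega> u X / \<epsilon> =
    (\<integral>z. indicator \<Omega> (X - \<epsilon> *\<^sub>R z) * ((u X - u (X - \<epsilon> *\<^sub>R z)) / \<epsilon> / norm z powr p) \<partial>lborel) /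
    (\<integral>z. indicator \<Omega> (X - \<epsilon> *\<^sub>R z) * (1 / norm z powr p) \<partial>lborel)"
proof -
  \<comment> \<open>Taking \<open>h\<close> as \<open>u X - u y\<close> and as 1 gives the same
    factor for numerator and denominator, so it cancels in the quotient.\<close>
  have *: "(\<integral>y. indicator \<Omega> y * (h y / norm (X - y) powr p) \<partial>lborel) =
      \<epsilon> ^ DIM('a) / \<epsilon> powr p * (\<integral>z. indicator \<Omega> (X - \<epsilon> *\<^sub>R z) * (h (X - \<epsilon> *\<^sub>R z) / norm z powr p) \<partial>lborel)"
    if [measurable]: "h \<in> borel_measurable borel" for h :: "'a \<Rightarrow> real"
  proof -
    have "(\<integral>y. indicator \<Omega> y * (h y / norm (X - y) powr p) \<partial>lborel) =
      \<epsilon> ^ DIM('a) * (\<integral>z. indicator \<Omega> (X - \<epsilon> *\<^sub>R z) * (h (X - \<epsilon> *\<^sub>R z) / norm (\<epsilon> *\<^sub>R z) powr p) \<partial>lborel)"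
      using integral_lborel_affine[of "\<lambda>y. indicator \<Omega> y * (h y / norm (X - y) powr p)" "- \<epsilon>" X] \<epsilon>
      by simp
    also have "(\<integral>z. indicator \<Omega> (X - \<epsilon> *\<^sub>R z) * (h (X - \<epsilon> *\<^sub>R z) / norm (\<epsilon> *\<^sub>R z) powr p) \<partial>lborel) =
      (\<integral>z. 1 / \<epsilon> powr p * (indicator \<Omega> (X - \<epsilon> *\<^sub>R z) * (h (X - \<epsilon> *\<^sub>R z) / norm z powr p)) \<partial>lborel)"
      using \<epsilon> by (intro Bochner_Integration.integral_cong) (auto simp: powr_mult)
    also have "\<dots> = 1 / \<epsilon> powr p * (\<integral>z. indicator \<Omega> (X - \<epsilon> *\<^sub>R z) * (h (X - \<epsilon> *\<^sub>R z) / norm z powr p) \<partial>lborel)"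
      by (rule integral_mult_right_zero)
    finally show ?thesis by simp
  qed
  let ?N = "\<integral>z. indicator \<Omega> (X - \<epsilon> *\<^sub>R z) * ((u X - u (X - \<epsilon> *\<^sub>R z)) / \<epsilon> / norm z powr p) \<partial>lborel"
  let ?D = "\<integral>z. indicator \<Omega> (X - \<epsilon> *\<^sub>R z) * (1 / norm z powr p) \<partial>lborel"
  have "(\<integral>z. indicator \<Omega> (X - \<epsilon> *\<^sub>R z) * ((u X - u (X - \<epsilon> *\<^sub>R z)) / norm z powr p) \<partial>lborel) = \<epsilon> * ?N"
    unfolding integral_mult_right_zero[symmetric]
    using \<epsilon> by (intro Bochner_Integration.integral_cong) auto
  then have "(\<integral>y. indicator \<Omega> y * ((u X - u y) / norm (X - y) powr p) \<partial>lborel) = \<epsilon> ^ DIM('a) / \<epsilon> powr p * (\<epsilon> * ?N)"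
    using *[of "\<lambda>y. u X - u y"] by simp
  moreover have "(\<integral>y. indicator \<Omega> y * (1 / norm (X - y) powr p) \<partial>lborel) = \<epsilon> ^ DIM('a) / \<epsilon> powr p * ?D"
    using *[of "\<lambda>y. 1"] by simp
  ultimately show ?thesis
    unfolding renorm_nonlocal_normal_deriv_def set_lebesgue_integral_def real_scaleR_def p[symmetric]
    using \<epsilon> by (simp only:) simp
qed

lemma renorm_nonlocal_normal_deriv_normal_limit:
  fixes \<Omega> :: "'a::euclidean_space set"
  assumes dom: "C1_domain \<Omega>" and s: "1 / 2 < s" and \<alpha>: "0 < \<alpha>" "\<alpha> < 2 * s - 1"
    and u: "C1_Holder \<alpha> u" and x: "x \<in> frontier \<Omega>" and ext: "exterior_unit_normal \<Omega> x \<nu>"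
    and p: "p = real DIM('a) + 2 * s"
  shows "((\<lambda>\<epsilon>. renorm_nonlocal_normal_deriv s \<Omega> u (x + \<epsilon> *\<^sub>R \<nu>) / \<epsilon>) \<longlongrightarrow>
    (\<integral>z. indicator {z. 1 < z \<bullet> \<nu>} z * ((z \<bullet> \<nu>) / norm z powr p) \<partial>lborel) /
    (\<integral>z. indicator {z. 1 < z \<bullet> \<nu>} z * (1 / norm z powr p) \<partial>lborel) * dir_deriv u x \<nu>) (at_right 0)"
proof -
  obtain g C0 where G: "\<And>x. GDERIV u x :> g x"
    and Hol0: "\<And>x y. norm (g x - g y) \<le> C0 * dist x y powr \<alpha>"
    using u unfolding C1_Holder_def by blast
  define C where "C = \<bar>C0\<bar>"
  have C: "0 \<le> C" by (simp add: C_def)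
  have Hol: "norm (g x - g y) \<le> C * dist x y powr \<alpha>" for x y
    by (rule order_trans[OF Hol0]) (simp add: C_def mult_right_mono)
  have \<nu>: "norm \<nu> = 1" using ext by (rule exterior_unit_normal_norm)
  have \<nu>\<nu>: "\<nu> \<bullet> \<nu> = 1" using \<nu> by (simp add: dot_square_norm)
  have [measurable]: "\<Omega> \<in> sets borel" using dom by (simp add: C1_domain_def)
  have "continuous_on UNIV u"
    using G by (intro differentiable_imp_continuous_on)
      (auto simp: differentiable_on_def differentiable_def gderiv_def)
  then have [measurable]: "u \<in> borel_measurable borel"
    by (rule borel_measurable_continuous_onI)
  have cone: "\<exists>\<delta>>0. \<forall>y. norm (y - x) < \<delta> \<longrightarrow>
      ((y - x) \<bullet> \<nu> < - \<eta> * norm (y - x) \<longrightarrow> y \<in> \<Omega>) \<and> (\<eta> * norm (y - x) < (y - x) \<bullet> \<nu> \<longrightarrow> y \<notin> \<Omega>)"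
    if \<eta>: "0 < \<eta>" for \<eta>
  proof -
    obtain e \<gamma> g' r where loc: "local_C1_graph \<Omega> x e \<gamma> g' r"
      and \<nu>_eq: "\<nu> = sgn (g' (x - (x \<bullet> e) *\<^sub>R e) - (g' (x - (x \<bullet> e) *\<^sub>R e) \<bullet> e) *\<^sub>R e - e)"
      using ext unfolding exterior_unit_normal_def Let_def by blast
    show ?thesis
      by (rule local_C1_graph_normal_cone[OF loc x refl \<nu>_eq \<eta>]) blast
  qed
  let ?H = "{z. 1 < z \<bullet> \<nu>}"
  let ?i = "\<lambda>t z. indicator \<Omega> (x + t *\<^sub>R \<nu> - t *\<^sub>R z) :: real"
  let ?q = "\<lambda>t z. (u (x + t *\<^sub>R \<nu>) - u (x + t *\<^sub>R \<nu> - t *\<^sub>R z)) / t"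
  have lim_cone: "((\<lambda>t. ?i t z) \<longlongrightarrow> indicator ?H z) (at_right 0)" if z: "z \<bullet> \<nu> \<noteq> 1" for z
  proof -
    define w where "w = \<nu> - z"
    have w\<nu>: "w \<bullet> \<nu> = 1 - z \<bullet> \<nu>" using \<nu>\<nu> by (simp add: w_def inner_simps)
    then have w: "w \<noteq> 0" "w \<bullet> \<nu> \<noteq> 0" using z by auto
    \<comment> \<open>The rescaled point is \<open>x + t *\<^sub>R w\<close>, which moves along a
      fixed ray. With \<open>\<eta>\<close> half the absolute cosine of the angle between
      \<open>w\<close> and \<open>\<nu>\<close>, the ray lies strictly inside one of the two cones
      once \<open>t * norm w < \<delta>\<close>.\<close>
    define \<eta> where "\<eta> = \<bar>w \<bullet> \<nu>\<bar> / (2 * norm w)"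
    have \<eta>: "0 < \<eta>" "\<eta> * norm w = \<bar>w \<bullet> \<nu>\<bar> / 2"
      using w by (simp_all add: \<eta>_def)
    obtain \<delta> where \<delta>: "0 < \<delta>" and in_out: "\<And>y. norm (y - x) < \<delta> \<Longrightarrow>
      ((y - x) \<bullet> \<nu> < - \<eta> * norm (y - x) \<longrightarrow> y \<in> \<Omega>) \<and> (\<eta> * norm (y - x) < (y - x) \<bullet> \<nu> \<longrightarrow> y \<notin> \<Omega>)"
      using cone[OF \<eta>(1)] by blast
    have "\<forall>\<^sub>F t in at_right 0. t \<in> {0<..<\<delta> / norm w}"
      using \<delta> w by (intro eventually_at_right_real) simp
    then have "\<forall>\<^sub>F t in at_right 0. indicator ?H z = ?i t z"
    proof eventually_elim
      case (elim t)
      then have t: "0 < t" "t * norm w < \<delta>"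
        using w by (auto simp: field_simps)
      have eq: "x + t *\<^sub>R \<nu> - t *\<^sub>R z = x + t *\<^sub>R w"
        by (simp add: w_def algebra_simps)
      have b: "(t * (w \<bullet> \<nu>) < - (t * (\<bar>w \<bullet> \<nu>\<bar> / 2)) \<longrightarrow> x + t *\<^sub>R w \<in> \<Omega>) \<and>
          (t * (\<bar>w \<bullet> \<nu>\<bar> / 2) < t * (w \<bullet> \<nu>) \<longrightarrow> x + t *\<^sub>R w \<notin> \<Omega>)"
        using in_out[of "x + t *\<^sub>R w"] t \<eta>(2) by (simp add: mult.left_commute)
      show ?case
      proof (cases "1 < z \<bullet> \<nu>")
        case True
        then have "w \<bullet> \<nu> < - (\<bar>w \<bullet> \<nu>\<bar> / 2)" using w\<nu> by (simp add: field_simps)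
        then have "t * (w \<bullet> \<nu>) < t * - (\<bar>w \<bullet> \<nu>\<bar> / 2)" using t(1) by (rule mult_strict_left_mono)
        then show ?thesis using b True unfolding eq by simp
      next
        case False
        then have "\<bar>w \<bullet> \<nu>\<bar> / 2 < w \<bullet> \<nu>" using w\<nu> z by simp
        then have "t * (\<bar>w \<bullet> \<nu>\<bar> / 2) < t * (w \<bullet> \<nu>)" using t(1) by (rule mult_strict_left_mono)
        then show ?thesis using b False unfolding eq by simp
      qed
    qed
    then show ?thesis by (rule tendsto_eventually[OF eventually_mono]) simp
  qed
  have AE_cone: "AE z in lborel. ((\<lambda>t. ?i t z) \<longlongrightarrow> indicator ?H z) (at_right 0)"
    by (rule eventually_mono[OF AE_lborel_hyperplane[of \<nu> 1] lim_cone]) (use \<nu> in auto)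
  have diff: "((\<lambda>t. (u (x + t *\<^sub>R w) - u x) / t) \<longlongrightarrow> w \<bullet> g x) (at_right 0)" for w
    using GDERIV_dir[OF G, of x w] unfolding DERIV_def
    by (auto intro: filterlim_mono[OF _ order_refl] simp: at_le)
  \<comment> \<open>Both increments are measured from \<open>x\<close>, so differentiability at this
    single point suffices.\<close>
  have lim_q: "((\<lambda>t. ?q t z) \<longlongrightarrow> z \<bullet> g x) (at_right 0)" for z
  proof -
    have "((\<lambda>t. (u (x + t *\<^sub>R \<nu>) - u x) / t - (u (x + t *\<^sub>R (\<nu> - z)) - u x) / t) \<longlongrightarrow>
        \<nu> \<bullet> g x - (\<nu> - z) \<bullet> g x) (at_right 0)"
      by (intro tendsto_diff diff)
    then show ?thesis
      by (simp add: inner_diff_left scaleR_diff_right add_diff_eq flip: diff_divide_distrib)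
  qed
  \<comment> \<open>For \<open>norm z < 1 / 2\<close> the vector \<open>\<nu> - z\<close> has norm
    at most 3/2 and component along \<open>\<nu>\<close> above 1/2, hence lies in the outer cone
    with constant 1/4. The rescaled domains thus avoid a common ball around the singularity
    \<open>z = 0\<close>.\<close>
  obtain b0 where b0: "0 < b0" and far0: "\<And>t z. 0 < t \<Longrightarrow> t < b0 \<Longrightarrow> norm z < 1 / 2 \<Longrightarrow> ?i t z = 0"
  proof -
    obtain \<delta> where \<delta>: "0 < \<delta>" and out: "\<And>y. norm (y - x) < \<delta> \<Longrightarrow> 1 / 4 * norm (y - x) < (y - x) \<bullet> \<nu> \<Longrightarrow> y \<notin> \<Omega>"
      using cone[of "1 / 4"] by auto
    show thesis
    proof (rule that[of "\<delta> / 2"])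
      fix t :: real and z :: 'a assume t: "0 < t" "t < \<delta> / 2" and z: "norm z < 1 / 2"
      have eq: "x + t *\<^sub>R \<nu> - t *\<^sub>R z - x = t *\<^sub>R (\<nu> - z)"
        by (simp add: algebra_simps)
      have n: "norm (\<nu> - z) \<le> 3 / 2"
        using norm_triangle_ineq4[of \<nu> z] \<nu> z by simp
      have "z \<bullet> \<nu> < 1 / 2"
        using norm_cauchy_schwarz[of z \<nu>] \<nu> z by simp
      then have "1 / 4 * norm (\<nu> - z) < (\<nu> - z) \<bullet> \<nu>"
        using n \<nu>\<nu> by (simp add: inner_diff_left)
      then have "t * (1 / 4 * norm (\<nu> - z)) < t * ((\<nu> - z) \<bullet> \<nu>)"
        using t(1) by (rule mult_strict_left_mono)
      moreover have "t * norm (\<nu> - z) < \<delta>"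
        using mult_left_mono[OF n, of t] t by linarith
      ultimately have "x + t *\<^sub>R \<nu> - t *\<^sub>R z \<notin> \<Omega>"
        using t by (intro out) (auto simp: eq)
      then show "?i t z = 0" by simp
    qed (use \<delta> in simp)
  qed
  define b where "b = min b0 1"
  have b: "0 < b" using b0 by (simp add: b_def)
  have far: "?i t z = 0" if "0 < t" "t < b" "norm z < 1 / 2" for t z
    using far0 that by (simp add: b_def)
  \<comment> \<open>The last inequality is where \<open>\<alpha> < 2 * s - 1\<close> enters: it
    makes \<open>norm z powr (1 + \<alpha> - p)\<close> integrable at infinity.\<close>
  have pD: "real DIM('a) < p" "real DIM('a) + 1 < p" and pa: "real DIM('a) < p - 1 - \<alpha>"
    using s \<alpha> p by auto
  define N where "N t = (\<integral>z. ?i t z * (?q t z / norm z powr p) \<partial>lborel)" for t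
  define D where "D t = (\<integral>z. ?i t z * (1 / norm z powr p) \<partial>lborel)" for t
  define A where "A = (\<integral>z. indicator ?H z * ((z \<bullet> \<nu>) / norm z powr p) \<partial>lborel)"
  define B where "B = (\<integral>z. indicator ?H z * (1 / norm z powr p) \<partial>lborel)"
  have D: "(D \<longlongrightarrow> B) (at_right 0)"
    unfolding D_def B_def
  proof (rule integral_dominated_convergence_at_right[where b = b])
    show "integrable lborel (\<lambda>z::'a. indicator {z. 1 / 2 \<le> norm z} z *\<^sub>R norm z powr - p)"
      using set_integrable_norm_powr[where 'a = 'a, of "1 / 2" p] pD by (simp add: set_integrable_def)
    show "AE z in lborel. ((\<lambda>t. ?i t z * (1 / norm z powr p)) \<longlongrightarrow> indicator ?H z * (1 / norm z powr p)) (at_right 0)"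
      using AE_cone by eventually_elim (intro tendsto_intros)
    fix t :: real assume t: "0 < t" "t < b"
    show "AE z in lborel. norm (?i t z * (1 / norm z powr p))
        \<le> indicator {z. 1 / 2 \<le> norm z} z *\<^sub>R norm z powr - p"
      using far[OF t] by (intro AE_I2) (auto simp: indicator_def powr_minus_divide not_le)
  qed (use b in measurable)
  have N: "(N \<longlongrightarrow> (\<integral>z. indicator ?H z * ((z \<bullet> g x) / norm z powr p) \<partial>lborel)) (at_right 0)"
    unfolding N_def
  proof (rule integral_dominated_convergence_at_right[where b = b])
    \<comment> \<open>For \<open>t \<le> 1\<close> and \<open>norm z \<ge> 1 / 2\<close> the radius
      \<open>t * (1 + norm z)\<close> is at most \<open>3 * norm z\<close>. Since also
      \<open>1 \<le> (3 * norm z) powr \<alpha>\<close>, the constant term \<open>norm (g x)\<close>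
      is absorbed into the same power.\<close>
    define K where "K = (norm (g x) + C) * 3 powr \<alpha>"
    show "integrable lborel (\<lambda>z::'a. K * (indicator {z. 1 / 2 \<le> norm z} z *\<^sub>R norm z powr - (p - 1 - \<alpha>)))"
      using set_integrable_norm_powr[where 'a = 'a, of "1 / 2" "p - 1 - \<alpha>"] pa
      by (intro integrable_mult_right) (simp add: set_integrable_def)
    show "AE z in lborel. ((\<lambda>t. ?i t z * (?q t z / norm z powr p)) \<longlongrightarrow> indicator ?H z * ((z \<bullet> g x) / norm z powr p)) (at_right 0)"
      using AE_cone
    proof eventually_elim
      case (elim z)
      show ?case
        using tendsto_mult[OF elim tendsto_mult[OF lim_q[of z] tendsto_const[of "1 / norm z powr p"]]]
        by simp
    qed
    fix t :: real assume t: "0 < t" "t < b"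
    have t1: "t \<le> 1" using t by (simp add: b_def)
    show "AE z in lborel. norm (?i t z * (?q t z / norm z powr p))
        \<le> K * (indicator {z. 1 / 2 \<le> norm z} z *\<^sub>R norm z powr - (p - 1 - \<alpha>))"
    proof (rule AE_I2)
      fix z :: 'a
      show "norm (?i t z * (?q t z / norm z powr p))
        \<le> K * (indicator {z. 1 / 2 \<le> norm z} z *\<^sub>R norm z powr - (p - 1 - \<alpha>))"
      proof (cases "1 / 2 \<le> norm z")
        case False
        then show ?thesis using far[OF t, of z] by simp
      next
        case z: True
        define R where "R = t * (1 + norm z)"
        have R: "0 \<le> R" using t by (simp add: R_def)
        have "R \<le> 1 * (1 + norm z)"
          unfolding R_def using t1 by (intro mult_right_mono) auto
        also have "\<dots> \<le> 3 * norm z" using z by simp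
        finally have R3: "R \<le> 3 * norm z" .
        have "\<bar>u (x + t *\<^sub>R \<nu>) - u (x + t *\<^sub>R \<nu> - t *\<^sub>R z)\<bar> \<le>
            (norm (g x) + C * R powr \<alpha>) * norm (x + t *\<^sub>R \<nu> - (x + t *\<^sub>R \<nu> - t *\<^sub>R z))"
        proof (rule C1_Holder_increment_bound[OF G Hol C])
          show "norm (x + t *\<^sub>R \<nu> - x) \<le> R"
            using t \<nu> by (simp add: R_def distrib_left)
          show "norm (x + t *\<^sub>R \<nu> - t *\<^sub>R z - x) \<le> R"
            using norm_triangle_ineq4[of "t *\<^sub>R \<nu>" "t *\<^sub>R z"] t \<nu> by (simp add: R_def distrib_left)
        qed (use \<alpha> in simp)
        also have "\<dots> = (norm (g x) + C * R powr \<alpha>) * norm z * t"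
          using t by simp
        finally have "\<bar>?q t z\<bar> \<le> (norm (g x) + C * R powr \<alpha>) * norm z"
          using t by (simp add: abs_divide divide_le_eq)
        also have "norm (g x) + C * R powr \<alpha> \<le> norm (g x) * (3 * norm z) powr \<alpha> + C * (3 * norm z) powr \<alpha>"
        proof (rule add_mono)
          have "1 \<le> (3 * norm z) powr \<alpha>" using z \<alpha> by (intro ge_one_powr_ge_zero) auto
          then show "norm (g x) \<le> norm (g x) * (3 * norm z) powr \<alpha>"
            using mult_left_mono[of 1 "(3 * norm z) powr \<alpha>" "norm (g x)"] by simp
          show "C * R powr \<alpha> \<le> C * (3 * norm z) powr \<alpha>"
            using R R3 \<alpha> C by (intro mult_left_mono powr_mono2) auto
        qed
        also have "\<dots> = K * norm z powr \<alpha>"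
          by (simp add: K_def powr_mult algebra_simps)
        finally have q: "\<bar>?q t z\<bar> \<le> K * norm z powr \<alpha> * norm z"
          by (simp add: mult_right_mono)
        have "norm (?i t z * (?q t z / norm z powr p)) \<le> \<bar>?q t z\<bar> / norm z powr p"
          by (simp add: indicator_def abs_mult)
        also have "\<dots> \<le> K * norm z powr \<alpha> * norm z / norm z powr p"
          using q by (intro divide_right_mono) auto
        also have "\<dots> = K * norm z powr - (p - 1 - \<alpha>)"
          using z by (simp add: powr_diff powr_minus_divide powr_add)
        finally show ?thesis using z by simp
      qed
    qed
  qed (use b in measurable)
  have "B \<noteq> 0"
    using half_space_integral_pos[OF \<nu> pD(1)] by (simp add: B_def)
  have "(N \<longlongrightarrow> (g x \<bullet> \<nu>) * A) (at_right 0)"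
    using N half_space_integral_inner(2)[OF \<nu> pD(2), of "g x"] by (simp only: A_def)
  from tendsto_divide[OF this D \<open>B \<noteq> 0\<close>]
  have "((\<lambda>t. N t / D t) \<longlongrightarrow> (g x \<bullet> \<nu>) * A / B) (at_right 0)" .
  moreover have "dir_deriv u x \<nu> = g x \<bullet> \<nu>"
    using GDERIV_dir[OF G, of x \<nu>] by (simp add: dir_deriv_def DERIV_imp_deriv inner_commute)
  ultimately have "((\<lambda>t. N t / D t) \<longlongrightarrow> A / B * dir_deriv u x \<nu>) (at_right 0)"
    by (simp add: mult.commute)
  moreover have "\<forall>\<^sub>F t in at_right 0. N t / D t = renorm_nonlocal_normal_deriv s \<Omega> u (x + t *\<^sub>R \<nu>) / t"
    using eventually_at_right_less
    by eventually_elim (simp add: N_def D_def renorm_nonlocal_normal_deriv_rescale[OF _ _ _ p])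
  ultimately show ?thesis
    unfolding A_def B_def by (rule Lim_transform_eventually)
qed

section \<open>Both boundary limits, with one constant for all domains and functions\<close>

theorem proposition5p4:
  shows "(\<forall>(\<Omega> :: 'a::euclidean_space set) u s.
            C1_domain \<Omega> \<and> continuous_on UNIV u \<and> 0 < s \<and> s < 1 \<longrightarrow>
            (renorm_nonlocal_normal_deriv s \<Omega> u \<longlongrightarrow> 0)
              (at_set_within (frontier \<Omega>) (- closure \<Omega>))) \<and>
         (\<forall>s::real. 1 / 2 < s \<and> s < 1 \<longrightarrow>
            (\<exists>\<kappa>>0. \<forall>(\<Omega> :: 'a set) u \<alpha>.
               C1_domain \<Omega> \<and> continuous_on UNIV u \<and>
               0 < \<alpha> \<and> \<alpha> < 2 * s - 1 \<and> C1_Holder \<alpha> u \<longrightarrow>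
               (\<forall>x\<in>frontier \<Omega>. \<forall>\<nu>. exterior_unit_normal \<Omega> x \<nu> \<longrightarrow>
                  ((\<lambda>\<epsilon>. renorm_nonlocal_normal_deriv s \<Omega> u (x + \<epsilon> *\<^sub>R \<nu>) / \<epsilon>)
                     \<longlongrightarrow> \<kappa> * dir_deriv u x \<nu>) (at_right 0))))"
proof (rule conjI; intro allI impI)
  fix \<Omega> :: "'a set" and u :: "'a \<Rightarrow> real" and s :: real
  assume "C1_domain \<Omega> \<and> continuous_on UNIV u \<and> 0 < s \<and> s < 1"
  \<comment> \<open>Disjointness from the exterior reduces convergence towards the whole frontier to
    convergence at each of its points.\<close>
  moreover have "frontier \<Omega> \<inter> - closure \<Omega> = {}"
    by (auto simp: frontier_def)
  ultimately show "(renorm_nonlocal_normal_deriv s \<Omega> u \<longlongrightarrow> 0) (at_set_within (frontier \<Omega>) (- closure \<Omega>))"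
    by (simp add: filterlim_at_set_within_iff renorm_nonlocal_normal_deriv_tendsto_0)
next
  fix s :: real assume s: "1 / 2 < s \<and> s < 1"
  define p where "p = real DIM('a) + 2 * s"
  define A where "A \<nu> = (\<integral>z. indicator {z. 1 < z \<bullet> \<nu>} z * ((z \<bullet> \<nu>) / norm z powr p) \<partial>lborel)" for \<nu> :: 'a
  define B where "B \<nu> = (\<integral>z. indicator {z. 1 < z \<bullet> \<nu>} z * (1 / norm z powr p) \<partial>lborel)" for \<nu> :: 'a
  \<comment> \<open>Any fixed unit vector serves: by rotation invariance \<open>A \<nu>\<close> and
    \<open>B \<nu>\<close> do not depend on the unit vector \<open>\<nu>\<close>, so
    \<open>\<kappa> = A e / B e\<close> depends only on the dimension and \<open>s\<close>.\<close>
  obtain e :: 'a where e: "norm e = 1"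
    using norm_Basis nonempty_Basis by blast
  have "0 < A e / B e"
    unfolding A_def B_def using s
    by (intro divide_pos_pos half_space_integral_inner_pos half_space_integral_pos e) (auto simp: p_def)
  moreover have AB: "A \<nu> = A e" "B \<nu> = B e" if \<nu>: "norm \<nu> = 1" for \<nu>
  proof -
    \<comment> \<open>The half-space indicator becomes an indicator of
      \<open>a = z \<bullet> \<nu>\<close>, which exhibits the two-argument form required for
      rotation.\<close>
    have "A \<nu> = (\<integral>z. (\<lambda>a n. indicator {1<..} a * (a / n powr p)) (z \<bullet> \<nu>) (norm z) \<partial>lborel)" for \<nu>
      by (simp add: A_def indicator_def)
    moreover have "B \<nu> = (\<integral>z. (\<lambda>a n. indicator {1<..} a * (1 / n powr p)) (z \<bullet> \<nu>) (norm z) \<partial>lborel)" for \<nu>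
      by (simp add: B_def indicator_def)
    ultimately show "A \<nu> = A e" "B \<nu> = B e"
      by (simp_all only:) (rule integral_lborel_rotate[OF \<nu> e]; measurable)+
  qed
  moreover have "((\<lambda>\<epsilon>. renorm_nonlocal_normal_deriv s \<Omega> u (x + \<epsilon> *\<^sub>R \<nu>) / \<epsilon>)
      \<longlongrightarrow> A e / B e * dir_deriv u x \<nu>) (at_right 0)"
    if "C1_domain \<Omega>" "0 < \<alpha>" "\<alpha> < 2 * s - 1" "C1_Holder \<alpha> u" "x \<in> frontier \<Omega>" "exterior_unit_normal \<Omega> x \<nu>"
    for \<Omega> :: "'a set" and u \<alpha> x \<nu>
    using renorm_nonlocal_normal_deriv_normal_limit[OF that(1) _ that(2-) p_def, folded A_def B_def] s
    by (simp add: AB exterior_unit_normal_norm[OF that(6)])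
  ultimately show "\<exists>\<kappa>>0. \<forall>(\<Omega> :: 'a set) u \<alpha>.
      C1_domain \<Omega> \<and> continuous_on UNIV u \<and> 0 < \<alpha> \<and> \<alpha> < 2 * s - 1 \<and> C1_Holder \<alpha> u \<longrightarrow>
      (\<forall>x\<in>frontier \<Omega>. \<forall>\<nu>. exterior_unit_normal \<Omega> x \<nu> \<longrightarrow>
        ((\<lambda>\<epsilon>. renorm_nonlocal_normal_deriv s \<Omega> u (x + \<epsilon> *\<^sub>R \<nu>) / \<epsilon>)
          \<longlongrightarrow> \<kappa> * dir_deriv u x \<nu>) (at_right 0))"
    by blast
qed

end
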